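(* If $G$ is a finite simple graph containing no induced subgraph isomorphic to $P_3\cup 2K_1$ and no induced subgraph isomorphic to $\overline{P_3\cup 2K_1}$, and $\omega(G)\geq 4$, then $\chi(G)\leq\omega(G)+1$.
   Context: $P_3\cup 2K_1$ denotes the disjoint union of a path on three vertices and two isolated vertices; $\overline{H}$ is the complement of $H$. $\omega(G)$ is the clique number and $\chi(G)$ the chromatic number. *)

theory Defs
  imports "HOL-Library.Ramsey" "HOL-Library.FuncSet"
begin

record 'a ugraph =
  verts :: "'a set"
  edges :: "'a set set"

definition finite_simple_graph :: "'a ugraph \<Rightarrow> bool" where
  "finite_simple_graph G \<longleftrightarrow> finite (verts G) \<and> edges G \<subseteq> [verts G]\<^bsup>2\<^esup>"

definition induced_subgraph :: "'a ugraph \<Rightarrow> 'a set \<Rightarrow> 'a ugraph" where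
  "induced_subgraph G S = \<lparr>verts = S, edges = {e \<in> edges G. e \<subseteq> S}\<rparr>"

definition graph_complement :: "'a ugraph \<Rightarrow> 'a ugraph" where
  "graph_complement G = \<lparr>verts = verts G, edges = [verts G]\<^bsup>2\<^esup> - edges G\<rparr>"

definition graph_isomorphic :: "'a ugraph \<Rightarrow> 'b ugraph \<Rightarrow> bool" where
  "graph_isomorphic G H \<longleftrightarrow>
     (\<exists>f. bij_betw f (verts G) (verts H) \<and>
       (\<forall>u \<in> verts G. \<forall>v \<in> verts G. {u, v} \<in> edges G \<longleftrightarrow> {f u, f v} \<in> edges H))"

definition contains_induced :: "'a ugraph \<Rightarrow> 'b ugraph \<Rightarrow> bool" where
  "contains_induced G H \<longleftrightarrow> (\<exists>S \<subseteq> verts G. graph_isomorphic (induced_subgraph G S) H)"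

definition complete_graph :: "nat \<Rightarrow> nat ugraph" where
  "complete_graph n = \<lparr>verts = {..<n}, edges = [{..<n}]\<^bsup>2\<^esup>\<rparr>"

text \<open>The path on \<open>n\<close> vertices, not on \<open>n\<close> edges.\<close>

definition path_graph :: "nat \<Rightarrow> nat ugraph" where
  "path_graph n = \<lparr>verts = {..<n}, edges = {{i, Suc i} |i. Suc i < n}\<rparr>"

definition disjoint_union :: "'a ugraph \<Rightarrow> 'b ugraph \<Rightarrow> ('a + 'b) ugraph" where
  "disjoint_union G H =
     \<lparr>verts = verts G <+> verts H,
      edges = image Inl ` edges G \<union> image Inr ` edges H\<rparr>"

definition P3_2K1 :: "(nat + nat + nat) ugraph" where
  "P3_2K1 = disjoint_union (path_graph 3) (disjoint_union (complete_graph 1) (complete_graph 1))"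

definition clique_number :: "'a ugraph \<Rightarrow> nat" where
  "clique_number G = Max (card ` {K. K \<subseteq> verts G \<and> clique K (edges G)})"

definition proper_colouring :: "'a ugraph \<Rightarrow> nat \<Rightarrow> ('a \<Rightarrow> nat) \<Rightarrow> bool" where
  "proper_colouring G k c \<longleftrightarrow>
     c \<in> verts G \<rightarrow> {..<k} \<and>
     (\<forall>u \<in> verts G. \<forall>v \<in> verts G. {u, v} \<in> edges G \<longrightarrow> c u \<noteq> c v)"

definition chromatic_number :: "'a ugraph \<Rightarrow> nat" where
  "chromatic_number G = (LEAST k. \<exists>c. proper_colouring G k c)"

end

theory Submission
  imports Defs
begin

text \<open>Let \<open>K\<close> be a maximum clique, of size \<open>w \<ge> 4\<close>. As \<open>G\<close> has no induced complement of
  \<open>P3 \<union> 2K1\<close>, the vertices missing exactly one vertex of \<open>K\<close> form a complete \<open>w\<close>-partite core,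
  and every other vertex has neighbours in at most one part of it. Let \<open>B\<close> be the set of these
  other vertices. It has no induced \<open>P3 \<union> K1\<close>, and an independent subset of \<open>B\<close> sees at most
  two parts, so a \<open>w\<close>-colouring of \<open>B\<close> yields a \<open>(w + 1)\<close>-colouring of \<open>G\<close>.

  If \<open>B\<close> has no \<open>K4\<close>, it is 4-colourable. Otherwise the same decomposition, applied to a
  maximum clique of \<open>B\<close>, gives a \<open>w\<close>-colouring unless \<open>B\<close> is the Hajos construction on two
  copies of a complete graph on \<open>w + 1\<close> vertices. In that case choose \<open>K\<close> with a core part as
  large as possible. Comparing the core of \<open>K\<close> with the cores of the maximum cliques inside \<open>B\<close>
  leaves only graphs on \<open>3w + 3\<close> vertices with an explicit \<open>(w + 1)\<close>-colouring.\<close>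

text \<open>The obstacle is the Hajos graph of \<open>hajos\<close> with \<open>n = w - 1\<close>:
  its clique number is \<open>w\<close> but it has no \<open>w\<close>-colouring, so if B is such a
  graph the extension step does not apply. What helps is that B then contains maximum cliques of the
  whole graph, namely \<open>insert x Q\<close> and \<open>insert x R\<close>, whose cores can be
  compared with the core of K. The part of \<open>insert x Q\<close> at \<open>x\<close> contains
  \<open>x\<close>, \<open>y\<close> and every core vertex of K attached there, so a largest part
  cannot belong to K unless it has many vertices itself, while nonadjacent pairs in B keep it small.
  Hence the extremal choice ranges over all maximum cliques and their parts. The bound
  \<open>w >= 4\<close> enters in three ways. A vertex outside the core sees at most one part, so
  three such vertices leave some vertex of K unseen, which completes a forbidden graph. After two
  vertices of K are set aside, two remain as the common neighbours in the complement of P3 + 2K1.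
  Finally, four colours are enough for a B without K4, because a graph with neither K4 nor three
  independent vertices has at most 8 vertices, by R(3,4) = 9.\<close>

section \<open>Choices, greedy selection and parity\<close>

lemma ex_not3:
  assumes "4 \<le> card K"
  obtains k where "k \<in> K" "k \<noteq> x" "k \<noteq> y" "k \<noteq> z"
proof -
  have "finite K" using assms by (metis card.infinite not_numeral_le_zero)
  have "card {x, y, z} \<le> 3"
    by (simp add: card_insert_if)
  then have "\<not> K \<subseteq> {x, y, z}"
    using assms card_mono[of "{x, y, z}" K] by auto
  then show ?thesis using that by blast
qed

lemma ex_not2:
  assumes "3 \<le> card K"
  obtains k where "k \<in> K" "k \<noteq> x" "k \<noteq> y"
proof -
  have "card {x, y} \<le> 2"
    by (simp add: card_insert_if)
  then have "\<not> K \<subseteq> {x, y}"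
    using assms card_mono[of "{x, y}" K] by auto
  then show ?thesis using that by blast
qed

text \<open>Greedy choice: when \<open>m\<close> is served, at most \<open>card M\<close> values are
  taken and at most \<open>d\<close> are forbidden to it. It is used with \<open>d = 2\<close> for
  colour classes and with \<open>d = 1\<close> for single vertices.\<close>

lemma ex_injective_choice:
  fixes T :: "'b \<Rightarrow> 'c set"
  assumes "finite M" "finite C"
    and "\<forall>c\<in>M. finite (T c) \<and> card (T c) \<le> d"
    and "card M + d \<le> card C"
  shows "\<exists>g. inj_on g M \<and> g ` M \<subseteq> C \<and> (\<forall>c\<in>M. g c \<notin> T c)"
  using assms
proof (induction M)
  case empty
  then show ?case by simp
next
  case (insert m M)
  then obtain g where g: "inj_on g M" "g ` M \<subseteq> C" "\<forall>c\<in>M. g c \<notin> T c"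
    by auto
  have "card (g ` M \<union> T m) \<le> card M + d"
    using insert.hyps insert.prems(2) by (meson add_mono card_Un_le card_image_le insertI1 le_trans)
  also have "\<dots> < card C"
    using insert by simp
  finally have "\<not> C \<subseteq> g ` M \<union> T m"
    using insert.hyps insert.prems(2) by (metis card_mono finite_Un finite_imageI insertI1 leD)
  then obtain c where c: "c \<in> C" "c \<notin> g ` M" "c \<notin> T m"
    by blast
  have "inj_on (g(m := c)) (insert m M)"
    using g(1) c(2) insert.hyps(2) by (auto simp: inj_on_def)
  moreover have "(g(m := c)) ` insert m M \<subseteq> C" "\<forall>a\<in>insert m M. (g(m := c)) a \<notin> T a"
    using g c insert.hyps(2) by auto
  ultimately show ?case by blast
qed

text \<open>Colours a clique with one vertex prescribed, so that cliques joined by few edges can be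
  coloured independently of each other.\<close>

lemma inj_with_value:
  assumes "finite C" "c \<in> C" "card C \<le> n" "m < n"
  shows "\<exists>f :: 'a \<Rightarrow> nat. inj_on f C \<and> f ` C \<subseteq> {..<n} \<and> f c = m"
proof -
  have "card (C - {c}) \<le> card ({..<n} - {m})" using assms by simp
  then obtain f where f: "f ` (C - {c}) \<subseteq> {..<n} - {m}" "inj_on f (C - {c})"
    using card_le_inj[of "C - {c}" "{..<n} - {m}"] assms(1) by auto
  have "inj_on (f(c := m)) C" using f by (auto simp: inj_on_def)
  moreover have "(f(c := m)) ` C \<subseteq> {..<n}" using f assms by auto
  ultimately show ?thesis by (intro exI[of _ "f(c := m)"]) simp
qed

text \<open>The handshake lemma. It will exclude a 3-regular nonadjacency graph on nine
  vertices.\<close>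

lemma even_sum_degrees:
  assumes "finite S" and sym: "\<And>u v. r u v \<Longrightarrow> r v u" and irrefl: "\<And>u. \<not> r u u"
  shows "even (\<Sum>v\<in>S. card {w\<in>S. r v w})"
  using assms(1)
proof (induction S)
  case empty
  then show ?case by simp
next
  case (insert x S)
  have 1: "{w \<in> insert x S. r x w} = {w\<in>S. r x w}"
    using irrefl by auto
  have 2: "card {w \<in> insert x S. r v w} = card {w\<in>S. r v w} + (if r x v then 1 else 0)"
    if "v \<in> S" for v
  proof (cases "r x v")
    case True
    then have "{w \<in> insert x S. r v w} = insert x {w\<in>S. r v w}" using sym by auto
    then show ?thesis using True insert.hyps by simp
  next
    case False
    then have "{w \<in> insert x S. r v w} = {w\<in>S. r v w}" using sym by auto
    then show ?thesis using False by simp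
  qed
  \<comment> \<open>Each new edge is counted once at \<open>x\<close> and once at its other end, so
    the sum grows by twice the degree of \<open>x\<close>.\<close>
  have "(\<Sum>v\<in>S. (if r x v then 1 else 0 :: nat)) = card {w\<in>S. r x w}"
    using insert.hyps by (simp add: sum.If_cases Int_def)
  then have "(\<Sum>v\<in>S. card {w\<in>insert x S. r v w}) = (\<Sum>v\<in>S. card {w\<in>S. r v w}) + card {w\<in>S. r x w}"
    using 2 by (simp add: sum.distrib)
  then show ?case using insert 1 by simp
qed

section \<open>Colourings and forbidden induced subgraphs\<close>

text \<open>With adjacency as a relation on the whole type, an induced subgraph is just a vertex
  set, so the decomposition can be applied to \<open>V\<close> and again to a subset of it.\<close>

locale adjacency =
  fixes adj :: "'a \<Rightarrow> 'a \<Rightarrow> bool" (infix "\<sim>" 50)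
  assumes adj_sym: "u \<sim> v \<Longrightarrow> v \<sim> u"
    and adj_irrefl: "\<not> u \<sim> u"
begin

definition complete_on :: "'a set \<Rightarrow> bool" where
  "complete_on K \<longleftrightarrow> (\<forall>u\<in>K. \<forall>v\<in>K. u \<noteq> v \<longrightarrow> u \<sim> v)"

definition proper_on :: "'a set \<Rightarrow> ('a \<Rightarrow> 'c) \<Rightarrow> bool" where
  "proper_on S f \<longleftrightarrow> (\<forall>u\<in>S. \<forall>v\<in>S. u \<sim> v \<longrightarrow> f u \<noteq> f v)"

definition colourable :: "'a set \<Rightarrow> nat \<Rightarrow> bool" where
  "colourable S k \<longleftrightarrow> (\<exists>f :: 'a \<Rightarrow> nat. f ` S \<subseteq> {..<k} \<and> proper_on S f)"

text \<open>Equivalently, \<open>S\<close> induces a disjoint union of cliques.\<close>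

definition P3_free :: "'a set \<Rightarrow> bool" where
  "P3_free S \<longleftrightarrow> (\<forall>p\<in>S. \<forall>q\<in>S. \<forall>r\<in>S. p \<sim> q \<longrightarrow> q \<sim> r \<longrightarrow> p \<noteq> r \<longrightarrow> p \<sim> r)"

text \<open>The vertex \<open>s\<close> need not be assumed distinct from \<open>p\<close>,
  \<open>q\<close>, \<open>r\<close>: each of these has a neighbour on the path, so the conclusion
  holds for it anyway. The same remark applies to \<open>s\<close> and \<open>t\<close> in
  \<open>P3_2K1_free\<close>.\<close>

definition P3_K1_free :: "'a set \<Rightarrow> bool" where
  "P3_K1_free S \<longleftrightarrow> (\<forall>p\<in>S. \<forall>q\<in>S. \<forall>r\<in>S. \<forall>s\<in>S.
     p \<sim> q \<longrightarrow> q \<sim> r \<longrightarrow> p \<noteq> r \<longrightarrow> \<not> p \<sim> r \<longrightarrow> s \<sim> p \<or> s \<sim> q \<or> s \<sim> r)"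

definition P3_2K1_free :: "'a set \<Rightarrow> bool" where
  "P3_2K1_free S \<longleftrightarrow> (\<forall>p\<in>S. \<forall>q\<in>S. \<forall>r\<in>S. \<forall>s\<in>S. \<forall>t\<in>S.
     p \<sim> q \<longrightarrow> q \<sim> r \<longrightarrow> p \<noteq> r \<longrightarrow> \<not> p \<sim> r \<longrightarrow> s \<noteq> t \<longrightarrow> \<not> s \<sim> t \<longrightarrow>
     s \<sim> p \<or> s \<sim> q \<or> s \<sim> r \<or> t \<sim> p \<or> t \<sim> q \<or> t \<sim> r)"

text \<open>The complement of \<open>P3 \<union> 2K1\<close> is \<open>K5\<close> minus the edges of a path \<open>a - c - b\<close>.\<close>

definition K5_minus_P3_free :: "'a set \<Rightarrow> bool" where
  "K5_minus_P3_free S \<longleftrightarrow> (\<forall>x\<in>S. \<forall>y\<in>S. \<forall>a\<in>S. \<forall>b\<in>S. \<forall>c\<in>S.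
     complete_on {x, y, a, b} \<longrightarrow> x \<noteq> y \<longrightarrow> a \<noteq> b \<longrightarrow> c \<sim> x \<longrightarrow> c \<sim> y \<longrightarrow> c \<sim> a \<or> c \<sim> b)"

lemma complete_on_subset: "complete_on K \<Longrightarrow> L \<subseteq> K \<Longrightarrow> complete_on L"
  by (auto simp: complete_on_def)

lemma complete_on_insert:
  "complete_on (insert v K) \<longleftrightarrow> complete_on K \<and> (\<forall>u\<in>K. u \<noteq> v \<longrightarrow> v \<sim> u)"
  using adj_sym by (auto simp: complete_on_def)

lemma max_complete_set:
  assumes "finite S"
  shows "\<exists>Q\<subseteq>S. complete_on Q \<and> (\<forall>L\<subseteq>S. complete_on L \<longrightarrow> card L \<le> card Q)"
proof -
  have "card J \<le> card S" if "J \<subseteq> S" for J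
    using that assms by (simp add: card_mono)
  then have "\<exists>Q. (Q \<subseteq> S \<and> complete_on Q) \<and> (\<forall>L. L \<subseteq> S \<and> complete_on L \<longrightarrow> card L \<le> card Q)"
    by (intro ex_has_greatest_nat[where k = "{}" and b = "Suc (card S)"])
      (auto simp: less_Suc_eq_le complete_on_def)
  then show ?thesis by blast
qed

lemma P3_K1_free_subset: "P3_K1_free S \<Longrightarrow> T \<subseteq> S \<Longrightarrow> P3_K1_free T"
  unfolding P3_K1_free_def by (meson subsetD)

lemma K5_minus_P3_free_subset: "K5_minus_P3_free S \<Longrightarrow> T \<subseteq> S \<Longrightarrow> K5_minus_P3_free T"
  unfolding K5_minus_P3_free_def by (meson subsetD)

text \<open>The working form of the condition: a vertex with two neighbours in a clique misses at
  most one vertex of that clique.\<close>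

lemma K5_minus_P3_freeD:
  assumes "K5_minus_P3_free V" "Q \<subseteq> V" "complete_on Q" "v \<in> V"
    and "x \<in> Q" "y \<in> Q" "v \<sim> x" "v \<sim> y" "x \<noteq> y"
    and "a \<in> Q" "b \<in> Q" "\<not> v \<sim> a" "\<not> v \<sim> b"
  shows "a = b"
proof (rule ccontr)
  assume "a \<noteq> b"
  moreover have "complete_on {x, y, a, b}"
    using assms complete_on_subset[of Q "{x, y, a, b}"] by simp
  ultimately show False
    using assms unfolding K5_minus_P3_free_def by blast
qed

lemma colourableI:
  fixes f :: "'a \<Rightarrow> 'c"
  assumes "f ` S \<subseteq> C" "finite C" "card C \<le> k" "proper_on S f"
  shows "colourable S k"
proof -
  obtain h :: "'c \<Rightarrow> nat" where h: "bij_betw h C {..<card C}"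
    using ex_bij_betw_finite_nat[OF assms(2)] by (auto simp: atLeast0LessThan)
  have "(h \<circ> f) ` S \<subseteq> {..<k}"
    using h assms by (auto simp: bij_betw_def) (metis image_subset_iff lessThan_iff less_le_trans subset_iff imageI)
  moreover have "proper_on S (h \<circ> f)"
    unfolding proper_on_def
  proof (intro ballI impI)
    fix u v assume uv: "u \<in> S" "v \<in> S" "u \<sim> v"
    then have "f u \<noteq> f v" "f u \<in> C" "f v \<in> C"
      using assms by (auto simp: proper_on_def)
    then show "(h \<circ> f) u \<noteq> (h \<circ> f) v"
      using h by (auto simp: bij_betw_def inj_on_def)
  qed
  ultimately show ?thesis unfolding colourable_def by blast
qed

lemma colourableE:
  assumes "colourable S k" "finite C" "k \<le> card C"
  obtains f :: "'a \<Rightarrow> 'c" where "f ` S \<subseteq> C" "proper_on S f"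
proof -
  obtain f :: "'a \<Rightarrow> nat" where f: "f ` S \<subseteq> {..<k}" "proper_on S f"
    using assms unfolding colourable_def by blast
  obtain h :: "nat \<Rightarrow> 'c" where h: "bij_betw h {..<card C} C"
    using ex_bij_betw_nat_finite[OF assms(2)] by (auto simp: atLeast0LessThan)
  have fk: "f u \<in> {..<card C}" if "u \<in> S" for u
    using f assms that by (metis image_subset_iff lessThan_iff less_le_trans)
  have "(h \<circ> f) ` S \<subseteq> C"
    using h fk by (auto simp: bij_betw_def)
  moreover have "proper_on S (h \<circ> f)"
    using f(2) fk h unfolding proper_on_def bij_betw_def inj_on_def by simp blast
  ultimately show thesis by (rule that)
qed

lemma colourable_mono: "colourable S k \<Longrightarrow> k \<le> l \<Longrightarrow> colourable S l"
  unfolding colourable_def by (meson lessThan_subset_iff order_trans)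

lemma colourable_Un:
  assumes "colourable S k" "colourable T l"
  shows "colourable (S \<union> T) (k + l)"
proof -
  obtain f :: "'a \<Rightarrow> nat" where f: "f ` S \<subseteq> {..<k}" "proper_on S f"
    using assms unfolding colourable_def by blast
  obtain g :: "'a \<Rightarrow> nat" where g: "g ` T \<subseteq> {k..<k+l}" "proper_on T g"
    using colourableE[OF assms(2), of "{k..<k+l}"] by auto
  have fg: "u \<in> S \<Longrightarrow> f u < k" "u \<in> T \<Longrightarrow> k \<le> g u \<and> g u < k + l" for u
    using f(1) g(1) by auto
  have "(\<lambda>v. if v \<in> S then f v else g v) ` (S \<union> T) \<subseteq> {..<k+l}"
    using fg by (auto intro: trans_less_add1)
  moreover have "proper_on (S \<union> T) (\<lambda>v. if v \<in> S then f v else g v)"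
    using f(2) g(2) fg unfolding proper_on_def by (metis Un_iff leD)
  ultimately show ?thesis unfolding colourable_def by blast
qed

lemma colourable_1:
  assumes "\<And>u v. u \<in> S \<Longrightarrow> v \<in> S \<Longrightarrow> \<not> u \<sim> v"
  shows "colourable S 1"
  unfolding colourable_def proper_on_def using assms by (intro exI[of _ "\<lambda>_. 0"]) auto

text \<open>The neighbours of a new vertex \<open>x\<close> form a clique together with
  \<open>x\<close>, so fewer than \<open>k\<close> colours are blocked.\<close>

lemma colourable_P3_free:
  assumes "finite S" "P3_free S"
    and "\<And>Q. Q \<subseteq> S \<Longrightarrow> complete_on Q \<Longrightarrow> card Q \<le> k"
  shows "colourable S k"
  using assms
proof (induction S)
  case empty
  then show ?case by (simp add: colourable_def proper_on_def)
next
  case (insert x S)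
  have "P3_free S" using insert.prems(1) unfolding P3_free_def by blast
  then obtain f :: "'a \<Rightarrow> nat" where f: "f ` S \<subseteq> {..<k}" "proper_on S f"
    using insert unfolding colourable_def by blast
  define N where "N = {v\<in>S. x \<sim> v}"
  have "complete_on (insert x N)"
    using insert.prems(1) adj_sym unfolding complete_on_insert N_def
    unfolding complete_on_def P3_free_def by blast
  then have "card (insert x N) \<le> k"
    using insert.prems(2)[of "insert x N"] by (auto simp: N_def)
  moreover have "finite N" "x \<notin> N" using insert.hyps by (auto simp: N_def)
  ultimately have "card (f ` N) < k"
    using card_image_le[of N f] by simp
  then have "\<not> {..<k} \<subseteq> f ` N"
    using \<open>finite N\<close> card_mono[of "f ` N" "{..<k}"] by auto
  then obtain c where c: "c < k" "c \<notin> f ` N" by auto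
  have "(f(x := c)) ` insert x S \<subseteq> {..<k}"
    using f c by auto
  moreover have "proper_on (insert x S) (f(x := c))"
    using f(2) c(2) adj_irrefl adj_sym unfolding proper_on_def N_def by auto
  ultimately show ?case unfolding colourable_def by blast
qed

text \<open>The vertices whose only non-neighbour in \<open>K\<close> is \<open>i\<close>. By
  irreflexivity \<open>i\<close> itself is one of them, so \<open>i\<close> represents its
  part.\<close>

definition part :: "'a set \<Rightarrow> 'a set \<Rightarrow> 'a \<Rightarrow> 'a set" where
  "part V K i = {v\<in>V. \<not> v \<sim> i \<and> (\<forall>k\<in>K - {i}. v \<sim> k)}"

definition core :: "'a set \<Rightarrow> 'a set \<Rightarrow> 'a set" where
  "core V K = (\<Union>i\<in>K. part V K i)"

abbreviation rest :: "'a set \<Rightarrow> 'a set \<Rightarrow> 'a set" where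
  "rest V K \<equiv> V - core V K"

end

section \<open>Maximum cliques\<close>

text \<open>Only the complement condition is carried here, so the same structure is available for
  the whole graph and for a subset with its own maximum clique.\<close>

locale max_clique = adjacency +
  fixes V K :: "'a set"
  assumes finite_V: "finite V"
    and K_sub: "K \<subseteq> V"
    and K_complete: "complete_on K"
    and K_card: "4 \<le> card K"
    and K_max: "Q \<subseteq> V \<Longrightarrow> complete_on Q \<Longrightarrow> card Q \<le> card K"
    and K5_minus_P3_free: "K5_minus_P3_free V"
begin

lemma finite_K: "finite K"
  using finite_V K_sub finite_subset by blast

lemma part_sub: "part V K i \<subseteq> V"
  by (auto simp: part_def)

lemma mem_V: "b \<in> rest V K \<Longrightarrow> b \<in> V" "u \<in> part V K i \<Longrightarrow> u \<in> V" "k \<in> K \<Longrightarrow> k \<in> V"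
  using K_sub by (auto simp: part_def)

lemma finite_part: "finite (part V K i)"
  using part_sub finite_V finite_subset by blast

lemma self_in_part: "i \<in> K \<Longrightarrow> i \<in> part V K i"
  using K_sub K_complete adj_irrefl by (auto simp: part_def complete_on_def)

lemma K_sub_core: "K \<subseteq> core V K"
  using self_in_part by (auto simp: core_def)

lemma part_unique: "u \<in> part V K i \<Longrightarrow> u \<in> part V K j \<Longrightarrow> i \<in> K \<Longrightarrow> j \<in> K \<Longrightarrow> i = j"
  by (auto simp: part_def)

lemma part_adj_K: "u \<in> part V K i \<Longrightarrow> k \<in> K \<Longrightarrow> k \<noteq> i \<Longrightarrow> u \<sim> k"
  by (auto simp: part_def)

lemma complete_exchange:
  assumes "i \<in> K" "u \<in> part V K i"
  shows "complete_on (insert u (K - {i}))"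
  unfolding complete_on_insert
  using assms complete_on_subset[OF K_complete] by (auto simp: part_def)

lemma no_dominating:
  assumes "v \<in> V"
  shows "\<exists>k\<in>K. \<not> v \<sim> k"
proof (rule ccontr)
  assume "\<not> ?thesis"
  then have *: "\<forall>k\<in>K. v \<sim> k" by blast
  then have "complete_on (insert v K)" "v \<notin> K"
    using K_complete adj_irrefl by (auto simp: complete_on_insert)
  then show False
    using K_max[of "insert v K"] assms K_sub finite_K by simp
qed

text \<open>Two adjacent vertices of one part could both replace \<open>i\<close> in
  \<open>K\<close>, giving a larger clique.\<close>

lemma part_independent:
  assumes "i \<in> K" "u \<in> part V K i" "v \<in> part V K i"
  shows "\<not> u \<sim> v"
proof
  assume uv: "u \<sim> v"
  have "u \<noteq> v" using uv adj_irrefl by auto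
  have "u \<noteq> i" "v \<noteq> i" using uv assms adj_sym by (auto simp: part_def)
  then have nin: "u \<notin> K - {i}" "v \<notin> insert u (K - {i})"
    using assms adj_irrefl \<open>u \<noteq> v\<close> by (auto simp: part_def)
  have "complete_on (insert v (insert u (K - {i})))"
    using complete_exchange[OF assms(1,2)] assms uv adj_sym
    unfolding complete_on_insert[of v] by (auto simp: part_def)
  moreover have "insert v (insert u (K - {i})) \<subseteq> V"
    using assms part_sub K_sub by blast
  moreover have "card (insert v (insert u (K - {i}))) = Suc (Suc (card K - 1))"
    using nin finite_K assms(1) by simp
  ultimately show False using K_max[of "insert v (insert u (K - {i}))"] by simp
qed

text \<open>If \<open>u\<close> and \<open>v\<close> were not adjacent, \<open>v\<close> would miss
  both \<open>u\<close> and \<open>j\<close> in the clique obtained from \<open>K\<close> by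
  replacing \<open>i\<close> by \<open>u\<close>, while seeing two further vertices
  \<open>x\<close>, \<open>y\<close> of it.\<close>

lemma parts_adj:
  assumes "i \<in> K" "j \<in> K" "i \<noteq> j" "u \<in> part V K i" "v \<in> part V K j"
  shows "u \<sim> v"
proof (rule ccontr)
  assume uv: "\<not> u \<sim> v"
  obtain x where x: "x \<in> K" "x \<noteq> i" "x \<noteq> j" by (rule ex_not3[OF K_card])
  obtain y where y: "y \<in> K" "y \<noteq> i" "y \<noteq> j" "y \<noteq> x" by (rule ex_not3[OF K_card])
  have "u = j"
  proof (rule K5_minus_P3_freeD[OF K5_minus_P3_free _ complete_exchange[OF assms(1,4)]])
    show "insert u (K - {i}) \<subseteq> V" "v \<in> V" using assms part_sub K_sub by blast+
    show "x \<in> insert u (K - {i})" "y \<in> insert u (K - {i})" "v \<sim> x" "v \<sim> y" "x \<noteq> y"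
      using x y assms part_adj_K by auto
    show "u \<in> insert u (K - {i})" "j \<in> insert u (K - {i})" "\<not> v \<sim> u" "\<not> v \<sim> j"
      using assms uv adj_sym by (auto simp: part_def)
  qed
  then show False using assms adj_irrefl part_unique self_in_part by blast
qed

text \<open>By maximality such a vertex misses some vertex of \<open>K\<close>, and being outside
  the core it misses a second one; two neighbours in \<open>K\<close> would then give the forbidden
  graph.\<close>

lemma rest_at_most_one_in_K:
  assumes "b \<in> rest V K" "x \<in> K" "y \<in> K" "b \<sim> x" "b \<sim> y"
  shows "x = y"
proof (rule ccontr)
  assume "x \<noteq> y"
  obtain k where k: "k \<in> K" "\<not> b \<sim> k" using no_dominating assms by blast
  then have "b \<notin> part V K k" "b \<in> V" using assms by (auto simp: core_def)
  then obtain l where l: "l \<in> K" "l \<noteq> k" "\<not> b \<sim> l" using k by (auto simp: part_def)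
  show False
    using K5_minus_P3_freeD[OF K5_minus_P3_free K_sub K_complete \<open>b \<in> V\<close> assms(2-5) \<open>x \<noteq> y\<close>] k l by blast
qed

text \<open>Put \<open>u\<close> and \<open>v\<close> in place of \<open>i\<close> and
  \<open>j\<close> in \<open>K\<close>. As \<open>b\<close> sees both, it misses at most one of two
  further vertices \<open>p\<close>, \<open>r\<close>, and by \<open>rest_at_most_one_in_K\<close>
  it sees at most one. So it sees one, \<open>s\<close>, and misses the other, \<open>t\<close>.
  Replacing only \<open>i\<close> by \<open>u\<close>, it now sees \<open>u\<close> and
  \<open>s\<close> but misses \<open>t\<close> and \<open>j\<close>.\<close>

lemma rest_one_part:
  assumes b: "b \<in> rest V K" and "i \<in> K" "j \<in> K" "u \<in> part V K i" "v \<in> part V K j" "b \<sim> u" "b \<sim> v"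
  shows "i = j"
proof (rule ccontr)
  assume "i \<noteq> j"
  have uv: "u \<sim> v" using parts_adj assms \<open>i \<noteq> j\<close> by blast
  obtain p where p: "p \<in> K" "p \<noteq> i" "p \<noteq> j" by (rule ex_not3[OF K_card])
  obtain r where r: "r \<in> K" "r \<noteq> i" "r \<noteq> j" "r \<noteq> p" by (rule ex_not3[OF K_card])
  have "b \<in> V" using b by simp
  have one: "\<not> b \<sim> r" if "b \<sim> p" using that rest_at_most_one_in_K[OF b] p r by blast
  have one': "\<not> b \<sim> p" if "b \<sim> r" using that rest_at_most_one_in_K[OF b] p r by blast
  define Q where "Q = insert v (insert u (K - {i}) - {j})"
  have "complete_on Q"
    unfolding Q_def complete_on_insert[of v]
    using complete_on_subset[OF complete_exchange[OF assms(2,4)]] uv adj_sym assms by (auto simp: part_def)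
  moreover have "Q \<subseteq> V" using assms part_sub K_sub by (auto simp: Q_def)
  moreover have "u \<noteq> j" using assms \<open>i \<noteq> j\<close> part_unique self_in_part by blast
  then have "u \<in> Q" "v \<in> Q" "p \<in> Q" "r \<in> Q" using p r by (auto simp: Q_def)
  moreover have "u \<noteq> v" using uv adj_irrefl by auto
  ultimately have "b \<sim> p \<or> b \<sim> r"
    using K5_minus_P3_freeD[OF K5_minus_P3_free, of Q b u v p r] assms r \<open>b \<in> V\<close> by blast
  then obtain s t where st: "s \<in> K" "s \<noteq> i" "s \<noteq> j" "t \<in> K" "t \<noteq> i" "t \<noteq> j" "b \<sim> s" "\<not> b \<sim> t"
    using p r one one' by metis
  have bj: "\<not> b \<sim> j" using rest_at_most_one_in_K[OF b st(1) assms(3) st(7)] st by blast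
  have "t = j"
  proof (rule K5_minus_P3_freeD[OF K5_minus_P3_free _ complete_exchange[OF assms(2,4)] \<open>b \<in> V\<close>])
    show "insert u (K - {i}) \<subseteq> V" using assms part_sub K_sub by blast
    show "u \<in> insert u (K - {i})" "s \<in> insert u (K - {i})" "t \<in> insert u (K - {i})" "j \<in> insert u (K - {i})"
      using st \<open>i \<noteq> j\<close> assms by auto
    show "b \<sim> u" "b \<sim> s" "\<not> b \<sim> t" "\<not> b \<sim> j" using st assms bj by auto
    show "u \<noteq> s" using part_adj_K[OF assms(4) st(1,2)] adj_irrefl by auto
  qed
  then show False using st by blast
qed

text \<open>The witness \<open>t\<close> is arbitrary when \<open>b\<close> has no neighbour in the
  core, which spares a case distinction whenever an unseen vertex of \<open>K\<close> is
  chosen.\<close>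

lemma rest_type:
  assumes "b \<in> rest V K"
  shows "\<exists>t. \<forall>i\<in>K. \<forall>u\<in>part V K i. b \<sim> u \<longrightarrow> i = t"
  using rest_one_part[OF assms] by blast

definition index :: "'a \<Rightarrow> 'a" where
  "index v = (THE i. i \<in> K \<and> v \<in> part V K i)"

lemma index_eq: "i \<in> K \<Longrightarrow> v \<in> part V K i \<Longrightarrow> index v = i"
  unfolding index_def using part_unique by (intro the_equality) auto

lemma index_core: "v \<in> core V K \<Longrightarrow> index v \<in> K \<and> v \<in> part V K (index v)"
  unfolding core_def using index_eq by auto

lemma index_proper: "u \<in> core V K \<Longrightarrow> v \<in> core V K \<Longrightarrow> u \<sim> v \<Longrightarrow> index u \<noteq> index v"
  using index_core part_independent by metis

text \<open>Parts are independent, so one colour \<open>e i\<close> per part is proper on the core;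
  only the edges between core and rest impose a condition.\<close>

lemma colouring_extend_core:
  fixes h :: "'a \<Rightarrow> 'c"
  assumes "proper_on (rest V K) h" "inj_on e K"
    and "\<And>b i u. b \<in> rest V K \<Longrightarrow> i \<in> K \<Longrightarrow> u \<in> part V K i \<Longrightarrow> b \<sim> u \<Longrightarrow> h b \<noteq> e i"
    and "h ` rest V K \<subseteq> C" "e ` K \<subseteq> C" "finite C" "card C \<le> k"
  shows "colourable V k"
proof (rule colourableI[OF _ assms(6,7)])
  define f where "f v = (if v \<in> core V K then e (index v) else h v)" for v
  show "f ` V \<subseteq> C"
    using assms(4,5) index_core by (auto simp: f_def)
  have c: "e (index u) \<noteq> e (index v)" if "u \<in> core V K" "v \<in> core V K" "u \<sim> v" for u v
    using index_proper[OF that] index_core that assms(2) by (auto simp: inj_on_def)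
  have m: "h b \<noteq> e (index u)" if "b \<in> rest V K" "u \<in> core V K" "b \<sim> u" for b u
    using assms(3) index_core that by blast
  show "proper_on V f"
    unfolding proper_on_def
  proof (intro ballI impI)
    fix u v assume uv: "u \<in> V" "v \<in> V" "u \<sim> v"
    show "f u \<noteq> f v"
      using c[of u v] m[of u v] m[of v u] uv adj_sym assms(1)
      by (auto simp: f_def proper_on_def dest: not_sym)
  qed
qed

end

section \<open>The vertices outside the core of a (P3 + 2K1)-free graph\<close>

locale max_clique_P3_2K1_free = max_clique +
  assumes P3_2K1_free: "P3_2K1_free V"
begin

lemma P3_2K1_freeD:
  assumes "p \<in> V" "q \<in> V" "r \<in> V" "s \<in> V" "t \<in> V"
    and "p \<sim> q" "q \<sim> r" "p \<noteq> r" "\<not> p \<sim> r" "s \<noteq> t" "\<not> s \<sim> t"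
    and "\<not> s \<sim> p" "\<not> s \<sim> q" "\<not> s \<sim> r" "\<not> t \<sim> p" "\<not> t \<sim> q" "\<not> t \<sim> r"
  shows False
  using P3_2K1_free[unfolded P3_2K1_free_def, rule_format, OF assms(1-11)] assms(12-) by blast

text \<open>For \<open>k\<close> in \<open>K\<close> unseen by \<open>b\<close>, \<open>c\<close>
  and \<open>d\<close>, the path \<open>b - u - k\<close> is induced and neither \<open>c\<close>
  nor \<open>d\<close> touches it.\<close>

lemma rest_nonneighbours_clique:
  assumes b: "b \<in> rest V K" "c \<in> rest V K" "d \<in> rest V K"
    and "i \<in> K" "u \<in> part V K i" "b \<sim> u"
    and "\<not> c \<sim> b" "\<not> d \<sim> b" "\<not> c \<sim> u" "\<not> d \<sim> u" "c \<noteq> d"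
  shows "c \<sim> d"
proof (rule ccontr)
  assume "\<not> c \<sim> d"
  obtain s where s: "\<forall>i\<in>K. \<forall>u\<in>part V K i. c \<sim> u \<longrightarrow> i = s" using rest_type[OF b(2)] by blast
  obtain t where t: "\<forall>i\<in>K. \<forall>u\<in>part V K i. d \<sim> u \<longrightarrow> i = t" using rest_type[OF b(3)] by blast
  obtain k where k: "k \<in> K" "k \<noteq> i" "k \<noteq> s" "k \<noteq> t" by (rule ex_not3[OF K_card])
  have "u \<sim> k" using part_adj_K[OF assms(5) k(1,2)] .
  moreover have "b \<noteq> k" using b k K_sub_core by blast
  moreover have "\<not> b \<sim> k" using rest_one_part[OF b(1) assms(4) k(1) assms(5) self_in_part[OF k(1)] assms(6)] k by blast
  moreover have "\<not> c \<sim> k" "\<not> d \<sim> k" using s t k self_in_part[OF k(1)] by blast+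
  moreover have "b \<in> V" "u \<in> V" "k \<in> V" "c \<in> V" "d \<in> V"
    using mem_V(1)[OF b(1)] mem_V(1)[OF b(2)] mem_V(1)[OF b(3)] mem_V(2)[OF assms(5)] mem_V(3)[OF k(1)] by simp_all
  ultimately show False
    using P3_2K1_freeD[of b u k c d] assms(6-11) \<open>\<not> c \<sim> d\<close> by blast
qed

text \<open>Here the induced path is \<open>u - k - w\<close>, with \<open>k\<close> in
  \<open>K\<close> unseen by \<open>b\<close> and \<open>c\<close>.\<close>

lemma part_pair_nonneighbours_clique:
  assumes "i \<in> K" "u \<in> part V K i" "w \<in> part V K i" "u \<noteq> w"
    and b: "b \<in> rest V K" "c \<in> rest V K"
    and "\<not> b \<sim> u" "\<not> b \<sim> w" "\<not> c \<sim> u" "\<not> c \<sim> w" "b \<noteq> c"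
  shows "b \<sim> c"
proof (rule ccontr)
  assume "\<not> b \<sim> c"
  obtain s where s: "\<forall>i\<in>K. \<forall>u\<in>part V K i. b \<sim> u \<longrightarrow> i = s" using rest_type[OF b(1)] by blast
  obtain t where t: "\<forall>i\<in>K. \<forall>u\<in>part V K i. c \<sim> u \<longrightarrow> i = t" using rest_type[OF b(2)] by blast
  obtain k where k: "k \<in> K" "k \<noteq> i" "k \<noteq> s" "k \<noteq> t" by (rule ex_not3[OF K_card])
  have "u \<sim> k" "k \<sim> w" using part_adj_K[OF assms(2) k(1,2)] part_adj_K[OF assms(3) k(1,2)] adj_sym by auto
  moreover have "\<not> b \<sim> k" "\<not> c \<sim> k" using s t k self_in_part[OF k(1)] by blast+
  moreover have "\<not> u \<sim> w" using assms part_independent by blast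
  moreover have "u \<in> V" "w \<in> V" "k \<in> V" "b \<in> V" "c \<in> V"
    using mem_V(1)[OF b(1)] mem_V(1)[OF b(2)] mem_V(2)[OF assms(2)] mem_V(2)[OF assms(3)] mem_V(3)[OF k(1)] by simp_all
  ultimately show False
    using P3_2K1_freeD[of u k w b c] assms(4,7-11) \<open>\<not> b \<sim> c\<close> by blast
qed

text \<open>A vertex \<open>k\<close> of \<open>K\<close> unseen by the path serves as the second
  isolated vertex, unless \<open>s\<close> sees it. In that case \<open>p\<close> and
  \<open>r\<close> both miss the edge \<open>s k\<close> and are adjacent by
  \<open>rest_nonneighbours_clique\<close>.\<close>

lemma rest_P3_K1_free: "P3_K1_free (rest V K)"
  unfolding P3_K1_free_def
proof (intro ballI impI, rule ccontr)
  fix p q r s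
  assume b: "p \<in> rest V K" "q \<in> rest V K" "r \<in> rest V K" "s \<in> rest V K"
    and a: "p \<sim> q" "q \<sim> r" "p \<noteq> r" "\<not> p \<sim> r" "\<not> (s \<sim> p \<or> s \<sim> q \<or> s \<sim> r)"
  obtain tp where tp: "\<forall>i\<in>K. \<forall>u\<in>part V K i. p \<sim> u \<longrightarrow> i = tp" using rest_type[OF b(1)] by blast
  obtain tq where tq: "\<forall>i\<in>K. \<forall>u\<in>part V K i. q \<sim> u \<longrightarrow> i = tq" using rest_type[OF b(2)] by blast
  obtain tr where tr: "\<forall>i\<in>K. \<forall>u\<in>part V K i. r \<sim> u \<longrightarrow> i = tr" using rest_type[OF b(3)] by blast
  obtain k where k: "k \<in> K" "k \<noteq> tp" "k \<noteq> tq" "k \<noteq> tr" by (rule ex_not3[OF K_card])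
  then have nk: "\<not> k \<sim> p" "\<not> k \<sim> q" "\<not> k \<sim> r"
    using tp tq tr self_in_part[OF k(1)] adj_sym by blast+
  have "s \<noteq> k" using b k K_sub_core by blast
  show False
  proof (cases "s \<sim> k")
    case False
    have "p \<in> V" "q \<in> V" "r \<in> V" "s \<in> V" "k \<in> V" using b K_sub k by auto
    then show False using P3_2K1_freeD[of p q r s k] a nk \<open>s \<noteq> k\<close> False by blast
  next
    case True
    then have "p \<sim> r"
      using rest_nonneighbours_clique[OF b(4,1,3) k(1) self_in_part[OF k(1)] True] a nk adj_sym by blast
    then show False using a by blast
  qed
qed

text \<open>Three pairwise nonadjacent vertices outside the core cannot be attached to three
  different parts, so a colour class on \<open>rest V K\<close> excludes the colours of at most two parts.
  Greedily, all classes but the last one get a colour; the last class is coloured vertex by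
  vertex with the two colours that are left, as each of its vertices sees only one part.\<close>

lemma colourable_from_rest:
  assumes "colourable (rest V K) (card K)"
  shows "colourable V (card K + 1)"
proof -
  let ?B = "rest V K"
  obtain f :: "'a \<Rightarrow> nat" where f: "f ` ?B \<subseteq> {..<card K}" "proper_on ?B f"
    using assms unfolding colourable_def by blast
  \<comment> \<open>\<open>Some i\<close> is the colour of part \<open>i\<close> and
    \<open>None\<close> the extra colour.\<close>
  define C where "C = insert None (Some ` K)"
  have finC: "finite C" and cardC: "card C = card K + 1"
    using finite_K by (auto simp: C_def card_image)
  \<comment> \<open>Class 0 is the one left for the end.\<close>
  define M where "M = f ` ?B - {0}"
  have "M \<subseteq> {1..<card K}" using f(1) by (auto simp: M_def)
  then have "finite M" and "card M \<le> card K - 1"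
    using finite_subset card_mono[of "{1..<card K}" M] by auto
  then have cardM: "card M + 2 \<le> card C" using K_card cardC by simp
  define T where "T c = {i\<in>K. \<exists>b\<in>?B. f b = c \<and> (\<exists>u\<in>part V K i. b \<sim> u)}" for c
  have T: "finite (T c) \<and> card (T c) \<le> 2" for c
  proof -
    have "finite (T c)" using finite_K by (auto simp: T_def)
    \<comment> \<open>Of three vertices of one class attached to three parts, the last two miss the
      first one and its core neighbour \<open>u\<close>, so they would be adjacent.\<close>
    moreover have "card (T c) \<le> 2"
    proof (rule ccontr)
      assume "\<not> card (T c) \<le> 2"
      then have "3 \<le> card (T c)" by simp
      then obtain i where i: "i \<in> T c" by (rule ex_not2)
      obtain j where j: "j \<in> T c" "j \<noteq> i" by (rule ex_not2[OF \<open>3 \<le> card (T c)\<close>])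
      obtain k where k: "k \<in> T c" "k \<noteq> i" "k \<noteq> j" by (rule ex_not2[OF \<open>3 \<le> card (T c)\<close>])
      obtain a u where a: "i \<in> K" "a \<in> ?B" "f a = c" "u \<in> part V K i" "a \<sim> u" using i by (auto simp: T_def)
      obtain b v where b: "j \<in> K" "b \<in> ?B" "f b = c" "v \<in> part V K j" "b \<sim> v" using j by (auto simp: T_def)
      obtain d w where d: "k \<in> K" "d \<in> ?B" "f d = c" "w \<in> part V K k" "d \<sim> w" using k by (auto simp: T_def)
      have same: "\<not> p \<sim> q" if "p \<in> ?B" "q \<in> ?B" "f p = f q" for p q
        using f(2) that by (auto simp: proper_on_def)
      have "\<not> b \<sim> u" using rest_one_part[OF b(2,1) a(1) b(4) a(4) b(5)] j by auto
      moreover have "\<not> d \<sim> u" using rest_one_part[OF d(2,1) a(1) d(4) a(4) d(5)] k by auto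
      moreover have ndv: "\<not> d \<sim> v" using rest_one_part[OF d(2,1) b(1) d(4) b(4) d(5)] k by auto
      moreover have "b \<noteq> d" using ndv b(5) by auto
      moreover have "\<not> b \<sim> a" "\<not> d \<sim> a" "\<not> b \<sim> d"
        using same a(2,3) b(2,3) d(2,3) by simp_all
      ultimately show False
        using rest_nonneighbours_clique[OF a(2) b(2) d(2) a(1) a(4,5)] by auto
    qed
    ultimately show ?thesis ..
  qed
  have "\<forall>c\<in>M. finite (Some ` T c) \<and> card (Some ` T c) \<le> 2"
    using T by (simp add: card_image)
  from ex_injective_choice[OF \<open>finite M\<close> finC this cardM] obtain g where g: "inj_on g M" "g ` M \<subseteq> C" "\<forall>c\<in>M. g c \<notin> Some ` T c"
    by blast
  define L where "L = C - g ` M"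
  have "card (g ` M) = card M" using g(1) by (rule card_image)
  then have "2 \<le> card L"
    using cardM g(2) finC by (simp add: L_def card_Diff_subset finite_subset)
  have pick: "\<exists>l\<in>L. \<forall>i\<in>K. \<forall>u\<in>part V K i. b \<sim> u \<longrightarrow> l \<noteq> Some i" if b: "b \<in> ?B" for b
  proof -
    obtain t where t: "\<forall>i\<in>K. \<forall>u\<in>part V K i. b \<sim> u \<longrightarrow> i = t" using rest_type[OF b] by blast
    have "card L \<le> card {Some t}" if "L \<subseteq> {Some t}"
      using that by (intro card_mono) auto
    then obtain l where l: "l \<in> L" "l \<noteq> Some t" using \<open>2 \<le> card L\<close> by fastforce
    have "\<forall>i\<in>K. \<forall>u\<in>part V K i. b \<sim> u \<longrightarrow> l \<noteq> Some i"
      using t l(2) by metis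
    then show ?thesis using l(1) by (rule bexI)
  qed
  define e where "e b = (SOME l. l \<in> L \<and> (\<forall>i\<in>K. \<forall>u\<in>part V K i. b \<sim> u \<longrightarrow> l \<noteq> Some i))" for b
  have e: "e b \<in> L" "\<And>i u. i \<in> K \<Longrightarrow> u \<in> part V K i \<Longrightarrow> b \<sim> u \<Longrightarrow> e b \<noteq> Some i" if "b \<in> ?B" for b
  proof -
    have "e b \<in> L \<and> (\<forall>i\<in>K. \<forall>u\<in>part V K i. b \<sim> u \<longrightarrow> e b \<noteq> Some i)"
      unfolding e_def using pick[OF that] unfolding Bex_def by (rule someI_ex)
    then show "e b \<in> L" "\<And>i u. i \<in> K \<Longrightarrow> u \<in> part V K i \<Longrightarrow> b \<sim> u \<Longrightarrow> e b \<noteq> Some i" by blast+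
  qed
  define h where "h b = (if f b \<in> M then g (f b) else e b)" for b
  have fM: "f b \<notin> M \<longleftrightarrow> f b = 0" if "b \<in> ?B" for b
    using that by (auto simp: M_def)
  show ?thesis
  proof (rule colouring_extend_core[of h Some C])
    show "proper_on ?B h"
      unfolding proper_on_def
    proof (intro ballI impI)
      fix u v assume uv: "u \<in> ?B" "v \<in> ?B" "u \<sim> v"
      have "f u \<noteq> f v" using f(2) uv by (auto simp: proper_on_def)
      have el: "e u \<notin> g ` M" "e v \<notin> g ` M"
        using e(1)[OF uv(1)] e(1)[OF uv(2)] by (simp_all add: L_def)
      consider "f u \<in> M" "f v \<in> M" | "f u \<in> M" "f v \<notin> M" | "f u \<notin> M" "f v \<in> M"
        using \<open>f u \<noteq> f v\<close> fM[OF uv(1)] fM[OF uv(2)] by metis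
      then show "h u \<noteq> h v"
      proof cases
        case 1
        then show ?thesis using inj_onD[OF g(1)] \<open>f u \<noteq> f v\<close> by (auto simp: h_def)
      next
        case 2
        then have "g (f u) \<in> g ` M" by blast
        then show ?thesis using 2 el by (metis h_def)
      next
        case 3
        then have "g (f v) \<in> g ` M" by blast
        then show ?thesis using 3 el by (metis h_def)
      qed
    qed
    show "h ` ?B \<subseteq> C" using g(2) e(1) by (auto simp: h_def L_def)
    show "Some ` K \<subseteq> C" by (auto simp: C_def)
    show "h b \<noteq> Some i" if "b \<in> ?B" "i \<in> K" "u \<in> part V K i" "b \<sim> u" for b i u
    proof (cases "f b \<in> M")
      case True
      then have "i \<in> T (f b)" using that by (auto simp: T_def)
      then show ?thesis using True g(3) by (auto simp: h_def)
    next
      case False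
      then show ?thesis using e(2)[OF that] by (simp add: h_def)
    qed
  qed (use finC cardC in auto)
qed

end

section \<open>Graphs without an induced P3 + K1\<close>

context adjacency
begin

definition independent :: "'a set \<Rightarrow> bool" where
  "independent S \<longleftrightarrow> (\<forall>u\<in>S. \<forall>v\<in>S. \<not> u \<sim> v)"

text \<open>In the complement this is the paw-free dichotomy: a component with a triangle is
  complete multipartite. Outside \<open>X\<close> each vertex is equal or adjacent to exactly one
  member \<open>e v\<close> of \<open>I\<close>, since two neighbours and a missed member of
  \<open>I\<close> would form P3 + K1. The fibres of \<open>e\<close> turn out to be cliques without
  edges between them.\<close>

lemma P3_K1_free_join:
  assumes "finite S" "P3_K1_free S"
    and I: "I \<subseteq> S" "independent I" "3 \<le> card I"
    and max: "\<forall>J\<subseteq>S. independent J \<longrightarrow> card J \<le> card I"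
  defines "X \<equiv> {v\<in>S. \<forall>i\<in>I. v \<sim> i}"
  shows "P3_free (S - X)" and "\<And>x y. x \<in> X \<Longrightarrow> y \<in> S - X \<Longrightarrow> x \<sim> y" and "S - X \<noteq> {}"
proof -
  have finI: "finite I" using assms(1) I(1) finite_subset by blast
  have forb: False if "p \<in> S" "q \<in> S" "r \<in> S" "s \<in> S" "p \<sim> q" "q \<sim> r" "p \<noteq> r" "\<not> p \<sim> r"
    "\<not> s \<sim> p" "\<not> s \<sim> q" "\<not> s \<sim> r" for p q r s
    using assms(2) that unfolding P3_K1_free_def by blast
  have nadj: "\<not> i \<sim> j" if "i \<in> I" "j \<in> I" for i j
    using I(2) that by (auto simp: independent_def)
  have IX: "I \<inter> X = {}" using nadj by (auto simp: X_def)
  have "I \<noteq> {}" using I(3) by auto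
  then show "S - X \<noteq> {}" using IX I(1) by auto
  have ex: "\<exists>i\<in>I. v = i \<or> v \<sim> i" if "v \<in> S" for v
  proof (rule ccontr)
    assume *: "\<not> ?thesis"
    then have "independent (insert v I)"
      using nadj adj_irrefl adj_sym by (auto simp: independent_def)
    then have "card (insert v I) \<le> card I" using max I(1) that by simp
    then show False using * finI by auto
  qed
  have uniq: "i = j" if v: "v \<in> S - X" and "i \<in> I" "j \<in> I" "v = i \<or> v \<sim> i" "v = j \<or> v \<sim> j" for v i j
  proof (cases "v \<in> I")
    case True
    then show ?thesis using that nadj by blast
  next
    case False
    then have v2: "v \<sim> i" "v \<sim> j" using that by auto
    show ?thesis
    proof (rule ccontr)
      assume "i \<noteq> j"
      obtain l where l: "l \<in> I" "\<not> v \<sim> l" using v by (auto simp: X_def)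
      then have "\<not> l \<sim> v" using adj_sym by blast
      moreover have "i \<in> S" "j \<in> S" "v \<in> S" "l \<in> S" using that I(1) l by auto
      ultimately show False
        using forb[of i v j l] v2 adj_sym[OF v2(1)] nadj[of i j] nadj[of l i] nadj[of l j] \<open>i \<noteq> j\<close> l that by blast
    qed
  qed
  define e where "e v = (SOME i. i \<in> I \<and> (v = i \<or> v \<sim> i))" for v
  have e: "e v \<in> I" "v = e v \<or> v \<sim> e v" if "v \<in> S" for v
  proof -
    have "e v \<in> I \<and> (v = e v \<or> v \<sim> e v)"
      unfolding e_def by (rule someI_ex) (use ex[OF that] in blast)
    then show "e v \<in> I" "v = e v \<or> v \<sim> e v" by auto
  qed
  have e_eq: "e v = i" if "v \<in> S - X" "i \<in> I" "v = i \<or> v \<sim> i" for v i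
    using uniq[OF that(1) _ that(2) _ that(3)] e[of v] that(1) by blast
  \<comment> \<open>Otherwise \<open>e u - u - v\<close> is an induced path, and a third member
    \<open>l\<close> of \<open>I\<close> misses it.\<close>
  have same: "e u = e v" if u: "u \<in> S - X" and v: "v \<in> S - X" and "u \<sim> v" for u v
  proof (rule ccontr)
    assume ne: "e u \<noteq> e v"
    have eu: "e u \<in> I" "u = e u \<or> u \<sim> e u" and ev: "e v \<in> I" "v = e v \<or> v \<sim> e v"
      using e u v by blast+
    have "u \<noteq> e u" using e_eq[OF v eu(1)] \<open>u \<sim> v\<close> adj_sym ne by metis
    moreover have "v \<noteq> e v" using e_eq[OF u ev(1)] \<open>u \<sim> v\<close> ne by metis
    ultimately have uv: "e u \<sim> u" "v \<sim> e v" using eu ev adj_sym by blast+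
    obtain l where l: "l \<in> I" "l \<noteq> e u" "l \<noteq> e v" by (rule ex_not2[OF I(3)])
    have nl: "\<not> l \<sim> u" "\<not> l \<sim> v" using e_eq[OF u l(1)] e_eq[OF v l(1)] l adj_sym by metis+
    have nv: "\<not> e u \<sim> v" using e_eq[OF v eu(1)] adj_sym ne by metis
    have "e u \<noteq> v" using \<open>v \<noteq> e v\<close> e_eq[OF v eu(1)] by metis
    then show False
      using forb[of "e u" u v l] uv \<open>u \<sim> v\<close> nl nv nadj[OF l(1) eu(1)] I(1) l(1) eu(1) u v by blast
  qed
  \<comment> \<open>Otherwise exchanging \<open>e u\<close> for \<open>u\<close> and
    \<open>v\<close> would enlarge the maximum independent set.\<close>
  have adj_same: "u \<sim> v" if u: "u \<in> S - X" and v: "v \<in> S - X" and "e u = e v" "u \<noteq> v" for u v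
  proof (rule ccontr)
    assume nuv: "\<not> u \<sim> v"
    have eu: "e u \<in> I" "u = e u \<or> u \<sim> e u" and ev: "v = e u \<or> v \<sim> e u"
      using e[of u] e[of v] u v \<open>e u = e v\<close> by auto
    have ne: "u \<noteq> e u" "v \<noteq> e u" using eu ev nuv \<open>u \<noteq> v\<close> adj_sym by auto
    have nI: "u \<notin> I" "v \<notin> I" using ne e_eq[OF u, of u] e_eq[OF v, of v] \<open>e u = e v\<close> by metis+
    have nui: "\<not> u \<sim> i" "\<not> v \<sim> i" "\<not> i \<sim> u" "\<not> i \<sim> v" if "i \<in> I - {e u}" for i
      using e_eq[OF u, of i] e_eq[OF v, of i] that \<open>e u = e v\<close> adj_sym by auto
    have "\<not> v \<sim> u" using nuv adj_sym by blast
    then have "independent (insert u (insert v (I - {e u})))"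
      using nuv adj_irrefl nadj nui unfolding independent_def by simp
    moreover have "insert u (insert v (I - {e u})) \<subseteq> S"
      using I(1) u v by auto
    ultimately have "card (insert u (insert v (I - {e u}))) \<le> card I"
      using max by simp
    moreover have "card (insert u (insert v (I - {e u}))) = Suc (Suc (card I - 1))"
      using nI \<open>u \<noteq> v\<close> finI eu(1) by simp
    ultimately show False using eu(1) finI card_gt_0_iff[of I] by auto
  qed
  show "P3_free (S - X)"
    unfolding P3_free_def
  proof (intro ballI impI)
    fix p q r assume *: "p \<in> S - X" "q \<in> S - X" "r \<in> S - X" "p \<sim> q" "q \<sim> r" "p \<noteq> r"
    then have "e p = e r" using same[OF *(1,2,4)] same[OF *(2,3,5)] by simp
    then show "p \<sim> r" using adj_same[OF *(1,3)] *(6) by blast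
  qed
  \<comment> \<open>Two members \<open>j\<close>, \<open>l\<close> of \<open>I\<close> other than
    \<open>e y\<close> give the induced path \<open>j - x - l\<close>, which \<open>y\<close> would
    miss.\<close>
  show "x \<sim> y" if "x \<in> X" "y \<in> S - X" for x y
  proof (rule ccontr)
    assume "\<not> x \<sim> y"
    have y: "y \<in> S" "e y \<in> I" using e that by blast+
    obtain j where j: "j \<in> I" "j \<noteq> e y" by (rule ex_not2[OF I(3)])
    obtain l where l: "l \<in> I" "l \<noteq> e y" "l \<noteq> j" by (rule ex_not2[OF I(3)])
    have "\<not> y \<sim> j" "\<not> y \<sim> l" using e_eq[OF that(2)] j l by blast+
    moreover have "j \<sim> x" "x \<sim> l" "x \<in> S" using that j l adj_sym by (auto simp: X_def)
    moreover have "\<not> y \<sim> x" using \<open>\<not> x \<sim> y\<close> adj_sym by blast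
    ultimately show False
      using forb[of j x l y] nadj[of j l] j l I(1) y(1) by blast
  qed
qed

lemma complete_on_triple: "x \<sim> y \<Longrightarrow> y \<sim> z \<Longrightarrow> x \<sim> z \<Longrightarrow> complete_on {x, y, z}"
  using adj_sym by (auto simp: complete_on_def)

lemma max_independent_set:
  assumes "finite S" "I \<subseteq> S" "independent I"
  shows "\<exists>J\<subseteq>S. independent J \<and> card I \<le> card J \<and> (\<forall>L\<subseteq>S. independent L \<longrightarrow> card L \<le> card J)"
proof -
  have "card J \<le> card S" if "J \<subseteq> S" for J
    using that assms(1) by (simp add: card_mono)
  then have "\<exists>J. (J \<subseteq> S \<and> independent J) \<and> (\<forall>L. L \<subseteq> S \<and> independent L \<longrightarrow> card L \<le> card J)"
    using assms by (intro ex_has_greatest_nat[where b = "Suc (card S)"]) (auto simp: less_Suc_eq_le)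
  then show ?thesis using assms by blast
qed

section \<open>Colouring (P3 + K1)-free graphs without K4\<close>

text \<open>With three independent vertices, \<open>P3_K1_free_join\<close> splits off an
  \<open>X\<close> that must be independent, and the remaining cliques have at most two vertices.
  Otherwise, for any \<open>v\<close>, its neighbours are independent and its non-neighbours form a
  clique of at most two vertices. Both ways the count is 1 + 2.\<close>

lemma colourable_3_of_triangle_free:
  assumes "finite S" "P3_K1_free S"
    and "\<And>Q. Q \<subseteq> S \<Longrightarrow> complete_on Q \<Longrightarrow> card Q \<le> 2"
  shows "colourable S 3"
proof (cases "\<exists>I\<subseteq>S. independent I \<and> 3 \<le> card I")
  case True
  then obtain I0 where I0: "I0 \<subseteq> S" "independent I0" "3 \<le> card I0" by blast
  obtain I where I: "I \<subseteq> S" "independent I" "card I0 \<le> card I"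
    and max: "\<forall>J\<subseteq>S. independent J \<longrightarrow> card J \<le> card I"
    using max_independent_set[OF assms(1) I0(1,2)] by blast
  have I3: "3 \<le> card I" using I(3) I0(3) by simp
  define X where "X = {v\<in>S. \<forall>i\<in>I. v \<sim> i}"
  note J = P3_K1_free_join[OF assms(1,2) I(1,2) I3 max, folded X_def]
  obtain y where y: "y \<in> S - X" using J(3) by blast
  have "colourable X 1"
  proof (rule colourable_1)
    fix u v assume uv: "u \<in> X" "v \<in> X"
    show "\<not> u \<sim> v"
    proof
      assume "u \<sim> v"
      then have "complete_on {u, v, y}" using J(2)[OF _ y] uv by (intro complete_on_triple)
      moreover have "card {u, v, y} = 3" using \<open>u \<sim> v\<close> uv y adj_irrefl by (auto simp: card_insert_if)
      ultimately show False using assms(3)[of "{u, v, y}"] uv y by (auto simp: X_def)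
    qed
  qed
  moreover have "colourable (S - X) 2"
    using colourable_P3_free[OF _ J(1), of 2] assms(1,3) by blast
  moreover have "X \<union> (S - X) = S" by (auto simp: X_def)
  ultimately show ?thesis using colourable_Un[of X 1 "S - X" 2] by (simp add: numeral_3_eq_3)
next
  case False
  show ?thesis
  proof (cases "S = {}")
    case True
    then show ?thesis by (simp add: colourable_def proper_on_def)
  next
    case False
    then obtain v where v: "v \<in> S" by blast
    define W where "W = {w\<in>S. w \<noteq> v \<and> \<not> v \<sim> w}"
    have "complete_on W"
      unfolding complete_on_def
    proof (intro ballI impI, rule ccontr)
      fix a b assume ab: "a \<in> W" "b \<in> W" "a \<noteq> b" "\<not> a \<sim> b"
      then have "independent {v, a, b}" "card {v, a, b} = 3" "{v, a, b} \<subseteq> S"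
        using v adj_irrefl adj_sym by (auto simp: W_def independent_def)
      then show False using \<open>\<not> (\<exists>I\<subseteq>S. independent I \<and> 3 \<le> card I)\<close> by (metis order_refl)
    qed
    then have "card W \<le> 2" using assms(3) by (auto simp: W_def)
    have "colourable {w\<in>S. v \<sim> w} 1"
    proof (rule colourable_1)
      fix a b assume ab: "a \<in> {w\<in>S. v \<sim> w}" "b \<in> {w\<in>S. v \<sim> w}"
      show "\<not> a \<sim> b"
      proof
        assume "a \<sim> b"
        then have "complete_on {v, a, b}" using ab by (intro complete_on_triple) auto
        moreover have "card {v, a, b} = 3" using \<open>a \<sim> b\<close> ab adj_irrefl by (auto simp: card_insert_if)
        ultimately show False using assms(3)[of "{v, a, b}"] ab v by auto
      qed
    qed
    moreover have "colourable (insert v W) 2"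
    proof -
      have "finite W" using assms(1) by (auto simp: W_def)
      then obtain h :: "'a \<Rightarrow> nat" where h: "inj_on h W" "h ` W = {0..<card W}"
        using ex_bij_betw_finite_nat[of W] by (auto simp: bij_betw_def)
      \<comment> \<open>Sharing colour 0 with a vertex of \<open>W\<close> is harmless, because
        \<open>v\<close> has no neighbour in \<open>W\<close>.\<close>
      define f where "f u = (if u = v then 0 else h u)" for u
      have "h w < 2" if "w \<in> W" for w
      proof -
        have "h w \<in> {0..<card W}" using h(2) that by blast
        then show ?thesis using \<open>card W \<le> 2\<close> by simp
      qed
      then have "f ` insert v W \<subseteq> {..<2}" by (auto simp: f_def)
      moreover have "proper_on (insert v W) f"
        using h(1) adj_irrefl adj_sym by (auto simp: proper_on_def f_def W_def inj_on_def)
      ultimately show ?thesis unfolding colourable_def by blast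
    qed
    moreover have "{w\<in>S. v \<sim> w} \<union> insert v W = S" using v by (auto simp: W_def)
    ultimately show ?thesis using colourable_Un[of "{w\<in>S. v \<sim> w}" 1 "insert v W" 2] by (simp add: numeral_3_eq_3)
  qed
qed

lemma colourable_cover:
  assumes "finite P" "\<And>e. e \<in> P \<Longrightarrow> independent e" "S \<subseteq> \<Union>P"
  shows "colourable S (card P)"
proof (rule colourableI[OF _ assms(1) order_refl])
  define f where "f v = (SOME e. e \<in> P \<and> v \<in> e)" for v
  have f: "f v \<in> P \<and> v \<in> f v" if "v \<in> S" for v
    unfolding f_def by (rule someI_ex) (use assms(3) that in blast)
  then show "f ` S \<subseteq> P" by blast
  show "proper_on S f"
    using f assms(2) unfolding proper_on_def independent_def by metis
qed

text \<open>Colour classes have at most two vertices, so the colouring is a matching of nonadjacent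
  pairs plus singletons. The Ramsey bound gives at most 8 vertices, and a maximum matching then
  leaves few enough singletons.\<close>

lemma colourable_4_of_alpha_2:
  assumes fin: "finite S"
    and clique: "\<And>Q. Q \<subseteq> S \<Longrightarrow> complete_on Q \<Longrightarrow> card Q \<le> 3"
    and indep: "\<And>I. I \<subseteq> S \<Longrightarrow> independent I \<Longrightarrow> card I \<le> 2"
  shows "colourable S 4"
proof -
  have noI3: False if "a \<in> S" "b \<in> S" "c \<in> S" "a \<noteq> b" "b \<noteq> c" "a \<noteq> c" "\<not> a \<sim> b" "\<not> b \<sim> c" "\<not> a \<sim> c" for a b c
  proof -
    have "independent {a, b, c}"
      using that adj_sym adj_irrefl by (auto simp: independent_def)
    then show False using indep[of "{a, b, c}"] that by simp
  qed
  have noK4: False if "a \<in> S" "b \<in> S" "c \<in> S" "d \<in> S" "a \<sim> b" "a \<sim> c" "a \<sim> d" "b \<sim> c" "b \<sim> d" "c \<sim> d" for a b c d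
  proof -
    have "complete_on {a, b, c, d}"
      using that adj_sym by (auto simp: complete_on_def)
    moreover have "a \<noteq> b" "a \<noteq> c" "a \<noteq> d" "b \<noteq> c" "b \<noteq> d" "c \<noteq> d" using that adj_irrefl by auto
    ultimately show False using clique[of "{a, b, c, d}"] that by simp
  qed
  define F where "F v = {w\<in>S. v \<sim> w}" for v
  define W where "W v = {w\<in>S. w \<noteq> v \<and> \<not> v \<sim> w}" for v
  have finFW: "finite (F v)" "finite (W v)" for v using fin by (auto simp: F_def W_def)
  have Wc: "complete_on (W v)" if "v \<in> S" for v
    unfolding complete_on_def W_def using noI3[of v] that by blast
  then have W3: "card (W v) \<le> 3" if "v \<in> S" for v
    using clique[of "W v"] that by (auto simp: W_def)
  \<comment> \<open>For a neighbour \<open>f\<close> of \<open>v\<close>, the common neighbours of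
    \<open>v\<close> and \<open>f\<close> are independent, and the neighbours of \<open>v\<close>
    missed by \<open>f\<close> form a clique together with \<open>v\<close>: this gives 1 + 2 +
    2.\<close>
  have F5: "card (F v) \<le> 5" if v: "v \<in> S" for v
  proof (cases "F v = {}")
    case True
    then show ?thesis by simp
  next
    case False
    then obtain f where f: "f \<in> S" "v \<sim> f" by (auto simp: F_def)
    have "independent (F v \<inter> F f)"
      unfolding independent_def F_def using noK4[OF v f(1) _ _ f(2)] by blast
    then have 1: "card (F v \<inter> F f) \<le> 2" using indep[of "F v \<inter> F f"] by (auto simp: F_def)
    have "complete_on (insert v (F v \<inter> W f))"
      using complete_on_subset[OF Wc[OF f(1)]] by (auto simp: complete_on_insert F_def)
    then have "card (insert v (F v \<inter> W f)) \<le> 3"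
      using clique[of "insert v (F v \<inter> W f)"] v by (auto simp: F_def)
    moreover have "v \<notin> F v \<inter> W f" using adj_irrefl by (auto simp: F_def)
    ultimately have 2: "card (F v \<inter> W f) \<le> 2" using finFW by simp
    have "F v \<subseteq> insert f ((F v \<inter> F f) \<union> (F v \<inter> W f))"
      by (auto simp: F_def W_def)
    then have "card (F v) \<le> card (insert f ((F v \<inter> F f) \<union> (F v \<inter> W f)))"
      using finFW by (intro card_mono) auto
    also have "\<dots> \<le> Suc (card ((F v \<inter> F f) \<union> (F v \<inter> W f)))"
      using finFW by (simp add: card_insert_if)
    also have "\<dots> \<le> Suc (card (F v \<inter> F f) + card (F v \<inter> W f))"
      using card_Un_le by simp
    finally show ?thesis using 1 2 by simp
  qed
  have split: "card S = Suc (card (F v) + card (W v))" if "v \<in> S" for v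
  proof -
    have "S = insert v (F v \<union> W v)" "v \<notin> F v \<union> W v" "F v \<inter> W v = {}"
      using that adj_irrefl by (auto simp: F_def W_def)
    then show ?thesis using finFW by (metis card_Un_disjoint card_insert_disjoint finite_UnI)
  qed
  have "card S \<le> 8"
  proof (rule ccontr)
    assume "\<not> card S \<le> 8"
    \<comment> \<open>With nine or more vertices all bounds are tight: every vertex has exactly
      three non-neighbours, and the degree sum 27 is odd.\<close>
    then have W: "card (W v) = 3" and "card S = 9" if "v \<in> S" for v
      using split[OF that] F5[OF that] W3[OF that] by linarith+
    moreover have "S \<noteq> {}" using \<open>\<not> card S \<le> 8\<close> by auto
    ultimately have S9: "card S = 9" by blast
    have "even (\<Sum>v\<in>S. card {w\<in>S. w \<noteq> v \<and> \<not> v \<sim> w})"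
      by (rule even_sum_degrees[OF fin]) (use adj_sym in auto)
    moreover have "(\<Sum>v\<in>S. card {w\<in>S. w \<noteq> v \<and> \<not> v \<sim> w}) = 27"
      using W S9 by (simp add: W_def)
    ultimately show False by simp
  qed
  define matching where "matching M \<longleftrightarrow>
    (\<forall>e\<in>M. e \<subseteq> S \<and> independent e \<and> card e = 2) \<and> pairwise disjnt M" for M
  have "matching {}" by (simp add: matching_def)
  moreover have "\<forall>M. matching M \<longrightarrow> card M < Suc (card (Pow S))"
    using fin by (auto simp: matching_def less_Suc_eq_le intro!: card_mono)
  ultimately obtain M where M: "matching M" and max: "\<forall>N. matching N \<longrightarrow> card N \<le> card M"
    using ex_has_greatest_nat[of matching "{}" card "Suc (card (Pow S))"] by blast
  have Me: "e \<subseteq> S" "independent e" "card e = 2" if "e \<in> M" for e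
    using M that by (auto simp: matching_def)
  have disj: "e \<inter> e' = {}" if "e \<in> M" "e' \<in> M" "e \<noteq> e'" for e e'
    using M that by (auto simp: matching_def pairwise_def disjnt_def)
  have finM: "finite M" using Me(1) fin by (meson Pow_iff finite_Pow_iff finite_subset subsetI)
  define U where "U = S - \<Union>M"
  have finU: "finite U" using fin by (simp add: U_def)
  have pair_matching: "matching (insert {a, b} N)"
    if "matching N" "a \<in> S" "b \<in> S" "a \<noteq> b" "\<not> a \<sim> b" "a \<notin> \<Union>N" "b \<notin> \<Union>N" for a b N
  proof -
    have "independent {a, b}" using that adj_sym adj_irrefl by (auto simp: independent_def)
    moreover have "pairwise disjnt (insert {a, b} N)"
      using that by (auto simp: matching_def pairwise_def disjnt_def)
    ultimately show ?thesis using that by (auto simp: matching_def)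
  qed
  have Uc: "complete_on U"
    unfolding complete_on_def
  proof (intro ballI impI, rule ccontr)
    fix a b assume ab: "a \<in> U" "b \<in> U" "a \<noteq> b" "\<not> a \<sim> b"
    then have "matching (insert {a, b} M)" using pair_matching[OF M, of a b] by (simp add: U_def)
    moreover have "{a, b} \<notin> M" using ab by (auto simp: U_def)
    ultimately show False using max finM by (metis card_insert_disjoint not_less_eq_eq order_refl)
  qed
  then have "card U \<le> 3" using clique[of U] by (auto simp: U_def)
  have "card (\<Union>M) = (\<Sum>e\<in>M. card e)"
    using M Me fin by (intro card_Union_disjoint) (auto simp: matching_def intro: finite_subset)
  also have "\<dots> = 2 * card M" using Me(3) by simp
  finally have "card (\<Union>M) = 2 * card M" .
  moreover have "\<Union>M \<subseteq> S" using Me(1) by blast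
  ultimately have cardS: "card S = 2 * card M + card U"
    using fin by (simp add: U_def card_Diff_subset finite_subset) (metis card_mono le_add_diff_inverse)
  \<comment> \<open>If both ends of a matched pair missed something in \<open>U\<close>, either the
    same vertex, giving an independent triple, or two vertices \<open>p\<close>, \<open>q\<close>,
    and then \<open>{a, p}\<close> and \<open>{b, q}\<close> would augment the matching.\<close>
  have good: "\<exists>b\<in>e. \<forall>u\<in>U. b \<sim> u" if e: "e \<in> M" for e
  proof -
    obtain a b where ab: "e = {a, b}" "a \<noteq> b" using Me(3)[OF e] by (auto simp: card_2_iff)
    have S: "a \<in> S" "b \<in> S" "\<not> a \<sim> b" using Me[OF e] ab by (auto simp: independent_def)
    have False if pq: "p \<in> U" "q \<in> U" "\<not> a \<sim> p" "\<not> b \<sim> q" for p q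
    proof -
      have ne: "p \<noteq> a" "p \<noteq> b" "q \<noteq> a" "q \<noteq> b" "p \<in> S" "q \<in> S" using pq e ab by (auto simp: U_def)
      show False
      proof (cases "p = q")
        case True
        then show False using noI3[of a b p] S ab ne pq by blast
      next
        case False
        define N where "N = M - {e}"
        have "matching N" using M by (auto simp: N_def matching_def pairwise_def disjnt_def)
        have "a \<notin> \<Union>N" "b \<notin> \<Union>N" using disj e ab by (auto simp: N_def)
        moreover have "p \<notin> \<Union>N" "q \<notin> \<Union>N" using pq by (auto simp: N_def U_def)
        ultimately have "matching (insert {a, p} N)" "b \<notin> \<Union>(insert {a, p} N)" "q \<notin> \<Union>(insert {a, p} N)"
          using pair_matching[OF \<open>matching N\<close>, of a p] S ne pq ab False by auto
        then have "matching (insert {b, q} (insert {a, p} N))"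
          using pair_matching[of "insert {a, p} N" b q] S ne pq by auto
        moreover have "{b, q} \<notin> insert {a, p} N" "{a, p} \<notin> N"
          using \<open>a \<notin> \<Union>N\<close> \<open>b \<notin> \<Union>N\<close> ab ne by auto
        moreover have "finite N" "card M = Suc (card N)"
          using finM e card_Suc_Diff1[OF finM e] by (simp_all add: N_def)
        ultimately show False using max[rule_format, of "insert {b, q} (insert {a, p} N)"] by simp
      qed
    qed
    then show ?thesis using ab by blast
  qed
  have "card M + card U \<le> 4"
  proof (rule ccontr)
    assume "\<not> card M + card U \<le> 4"
    \<comment> \<open>In the first case a good end of a pair forms a K4 with \<open>U\<close>. In
      the second, the good ends of the three pairs all see the edge \<open>U\<close>, hence are
      pairwise nonadjacent, an independent triple.\<close>
    then have mu: "card U = 3 \<and> card M = 2 \<or> card U = 2 \<and> card M = 3"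
      using cardS \<open>card S \<le> 8\<close> \<open>card U \<le> 3\<close> by presburger
    show False
    proof (cases "card U = 3")
      case True
      then obtain u v w where U: "U = {u, v, w}" "u \<noteq> v" "v \<noteq> w" "u \<noteq> w"
        by (metis card_3_iff)
      have "M \<noteq> {}" using mu by auto
      then obtain e where "e \<in> M" by blast
      then obtain b where b: "b \<in> S" "\<forall>u\<in>U. b \<sim> u" using good Me(1) by blast
      have "u \<in> S" "v \<in> S" "w \<in> S" "u \<sim> v" "v \<sim> w" "u \<sim> w"
        using U Uc by (auto simp: U_def complete_on_def)
      then show False using noK4[of b u v w] b U by blast
    next
      case False
      then obtain u v where U: "U = {u, v}" "u \<noteq> v" using mu by (metis card_2_iff)
      have uv: "u \<in> S" "v \<in> S" "u \<sim> v" using U Uc by (auto simp: U_def complete_on_def)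
      obtain e1 e2 e3 where e: "M = {e1, e2, e3}" "e1 \<noteq> e2" "e2 \<noteq> e3" "e1 \<noteq> e3"
        using mu False by (metis card_3_iff)
      obtain b1 where b1: "b1 \<in> e1" "\<forall>u\<in>U. b1 \<sim> u" using good[of e1] e(1) by blast
      obtain b2 where b2: "b2 \<in> e2" "\<forall>u\<in>U. b2 \<sim> u" using good[of e2] e(1) by blast
      obtain b3 where b3: "b3 \<in> e3" "\<forall>u\<in>U. b3 \<sim> u" using good[of e3] e(1) by blast
      have inS: "b1 \<in> S" "b2 \<in> S" "b3 \<in> S" using b1 b2 b3 Me(1) e(1) by blast+
      have "b1 \<noteq> b2" "b2 \<noteq> b3" "b1 \<noteq> b3"
        using disj[of e1 e2] disj[of e2 e3] disj[of e1 e3] e b1 b2 b3 by blast+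
      moreover have na: "\<not> x \<sim> y" if "x \<in> S" "y \<in> S" "\<forall>u\<in>U. x \<sim> u" "\<forall>u\<in>U. y \<sim> u" for x y
        using noK4[of x y u v] that uv U(1) by blast
      moreover have "\<not> b1 \<sim> b2" "\<not> b2 \<sim> b3" "\<not> b1 \<sim> b3"
        using na b1 b2 b3 inS by blast+
      ultimately show False using noI3[of b1 b2 b3] inS by blast
    qed
  qed
  moreover have "colourable S (card (M \<union> (\<lambda>v. {v}) ` U))"
  proof (rule colourable_cover)
    show "finite (M \<union> (\<lambda>v. {v}) ` U)" using finM finU by simp
    show "independent e" if "e \<in> M \<union> (\<lambda>v. {v}) ` U" for e
      using that Me(2) adj_irrefl by (auto simp: independent_def)
    show "S \<subseteq> \<Union>(M \<union> (\<lambda>v. {v}) ` U)" by (auto simp: U_def)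
  qed
  moreover have "card (M \<union> (\<lambda>v. {v}) ` U) \<le> card M + card U"
    using card_Un_le[of M "(\<lambda>v. {v}) ` U"] card_image_le[OF finU, of "\<lambda>v. {v}"] by simp
  ultimately show ?thesis using colourable_mono by (meson le_trans)
qed

text \<open>With three independent vertices the join decides: if \<open>X\<close> has an edge, the
  other side is independent and \<open>X\<close> is triangle-free, giving 3 + 1; if not,
  \<open>X\<close> takes one colour and the cliques of the other side three.\<close>

lemma colourable_4_of_K4_free:
  assumes "finite S" "P3_K1_free S"
    and clique: "\<And>Q. Q \<subseteq> S \<Longrightarrow> complete_on Q \<Longrightarrow> card Q \<le> 3"
  shows "colourable S 4"
proof (cases "\<exists>I\<subseteq>S. independent I \<and> 3 \<le> card I")
  case True
  then obtain I0 where I0: "I0 \<subseteq> S" "independent I0" "3 \<le> card I0" by blast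
  obtain I where I: "I \<subseteq> S" "independent I" "card I0 \<le> card I"
    and max: "\<forall>J\<subseteq>S. independent J \<longrightarrow> card J \<le> card I"
    using max_independent_set[OF assms(1) I0(1,2)] by blast
  have I3: "3 \<le> card I" using I(3) I0(3) by simp
  define X where "X = {v\<in>S. \<forall>i\<in>I. v \<sim> i}"
  note J = P3_K1_free_join[OF assms(1,2) I(1,2) I3 max, folded X_def]
  obtain y where y: "y \<in> S - X" using J(3) by blast
  have XS: "X \<subseteq> S" "X \<union> (S - X) = S" by (auto simp: X_def)
  show ?thesis
  proof (cases "\<exists>u\<in>X. \<exists>v\<in>X. u \<sim> v")
    case True
    then obtain u v where uv: "u \<in> X" "v \<in> X" "u \<sim> v" by blast
    have "colourable X 3"
    proof (rule colourable_3_of_triangle_free)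
      show "finite X" "P3_K1_free X" using XS assms(1,2) P3_K1_free_subset finite_subset by blast+
      fix Q assume Q: "Q \<subseteq> X" "complete_on Q"
      then have "complete_on (insert y Q)"
        using J(2)[OF _ y] adj_sym by (auto simp: complete_on_insert)
      moreover have "finite Q" "y \<notin> Q" using Q XS y assms(1) by (auto intro: finite_subset)
      ultimately show "card Q \<le> 2" using clique[of "insert y Q"] Q XS y by auto
    qed
    moreover have "colourable (S - X) 1"
    proof (rule colourable_1)
      fix a b assume ab: "a \<in> S - X" "b \<in> S - X"
      show "\<not> a \<sim> b"
      proof
        assume "a \<sim> b"
        then have "complete_on {u, v, a, b}"
          using J(2)[OF uv(1)] J(2)[OF uv(2)] ab uv(3) adj_sym by (auto simp: complete_on_def)
        moreover have "card {u, v, a, b} = 4"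
          using \<open>a \<sim> b\<close> uv ab adj_irrefl by (auto simp: card_insert_if)
        ultimately show False using clique[of "{u, v, a, b}"] uv ab XS by auto
      qed
    qed
    ultimately show ?thesis using colourable_Un[of X 3 "S - X" 1] XS(2) by simp
  next
    case False
    then have "colourable X 1" by (intro colourable_1) blast
    moreover have "colourable (S - X) 3"
      using colourable_P3_free[OF _ J(1), of 3] assms(1) clique by blast
    ultimately show ?thesis using colourable_Un[of X 1 "S - X" 3] XS(2) by simp
  qed
next
  case False
  then have "card I \<le> 2" if "I \<subseteq> S" "independent I" for I
    using that by (metis not_less_eq_eq numeral_2_eq_2 numeral_3_eq_3)
  then show ?thesis using colourable_4_of_alpha_2[OF assms(1) clique] by blast
qed

text \<open>The Hajos construction on two complete graphs with \<open>n + 2\<close> vertices: they are glued at \<open>x\<close>,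
  the edges \<open>x y\<close> and \<open>x z\<close> are removed and \<open>y z\<close> is added. It has clique number \<open>n + 1\<close> and chromatic
  number \<open>n + 2\<close>.\<close>

definition hajos :: "'a set \<Rightarrow> nat \<Rightarrow> 'a \<Rightarrow> 'a \<Rightarrow> 'a \<Rightarrow> 'a set \<Rightarrow> 'a set \<Rightarrow> bool" where
  "hajos S n x y z Q R \<longleftrightarrow> S = Q \<union> R \<union> {x, y, z} \<and>
     complete_on (insert x Q) \<and> complete_on (insert y Q) \<and>
     complete_on (insert x R) \<and> complete_on (insert z R) \<and>
     card Q = n \<and> card R = n \<and> x \<notin> Q \<union> R \<and> y \<notin> Q \<union> R \<and> z \<notin> Q \<union> R \<and>
     x \<noteq> y \<and> x \<noteq> z \<and> y \<sim> z \<and> \<not> x \<sim> y \<and> \<not> x \<sim> z \<and>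
     (\<forall>q\<in>Q. \<forall>r\<in>R. \<not> q \<sim> r) \<and> (\<forall>q\<in>Q. \<not> z \<sim> q) \<and> (\<forall>r\<in>R. \<not> y \<sim> r)"

lemma hajos_sym: "hajos S n x y z Q R \<Longrightarrow> hajos S n x z y R Q"
  unfolding hajos_def using adj_sym by (auto simp: insert_commute Un_commute)

lemma hajosD:
  assumes "hajos S n x y z Q R" "2 \<le> n"
  shows "S = Q \<union> R \<union> {x, y, z}" "Q \<inter> R = {}"
    "complete_on (insert x Q)" "complete_on (insert y Q)" "complete_on (insert x R)" "complete_on (insert z R)"
    "card Q = n" "card R = n" "x \<notin> Q" "y \<notin> Q" "x \<notin> R" "z \<notin> R"
    "x \<noteq> y" "x \<noteq> z" "y \<sim> z" "\<not> x \<sim> y" "\<not> x \<sim> z"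
    "\<And>q r. q \<in> Q \<Longrightarrow> r \<in> R \<Longrightarrow> \<not> q \<sim> r" "\<And>q. q \<in> Q \<Longrightarrow> \<not> z \<sim> q" "\<And>r. r \<in> R \<Longrightarrow> \<not> y \<sim> r"
proof -
  show qr: "\<not> q \<sim> r" if "q \<in> Q" "r \<in> R" for q r using assms that by (auto simp: hajos_def)
  \<comment> \<open>A common vertex would be adjacent, through \<open>R\<close>, to a second vertex
    of \<open>Q\<close>; \<open>2 \<le> n\<close> provides that vertex.\<close>
  show "Q \<inter> R = {}"
  proof (rule ccontr)
    assume "Q \<inter> R \<noteq> {}"
    then obtain q where q: "q \<in> Q" "q \<in> R" by blast
    have "\<not> Q \<subseteq> {q}" using assms card_mono[of "{q}" Q] by (auto simp: hajos_def)
    then obtain p where "p \<in> Q" "p \<noteq> q" by blast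
    then have "p \<sim> q" using assms(1) q by (auto simp: hajos_def complete_on_def)
    then show False using qr q \<open>p \<in> Q\<close> by blast
  qed
qed (use assms in \<open>auto simp: hajos_def\<close>)

end

section \<open>Maximum cliques of size at least four in (P3 + K1)-free graphs\<close>

locale max_clique_P3_K1_free = max_clique +
  assumes P3_K1_free: "P3_K1_free V"
begin

lemma P3_K1_freeD:
  assumes "p \<in> V" "q \<in> V" "r \<in> V" "s \<in> V"
    and "p \<sim> q" "q \<sim> r" "p \<noteq> r" "\<not> p \<sim> r"
    and "\<not> s \<sim> p" "\<not> s \<sim> q" "\<not> s \<sim> r"
  shows False
  using P3_K1_free[unfolded P3_K1_free_def, rule_format, OF assms(1-8)] assms(9-) by blast

text \<open>A vertex of \<open>K\<close> unseen by the three path vertices would be the isolated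
  vertex of P3 + K1.\<close>

lemma rest_P3_free: "P3_free (rest V K)"
  unfolding P3_free_def
proof (intro ballI impI, rule ccontr)
  fix p q r
  assume b: "p \<in> rest V K" "q \<in> rest V K" "r \<in> rest V K"
    and a: "p \<sim> q" "q \<sim> r" "p \<noteq> r" "\<not> p \<sim> r"
  obtain tp where tp: "\<forall>i\<in>K. \<forall>u\<in>part V K i. p \<sim> u \<longrightarrow> i = tp" using rest_type[OF b(1)] by blast
  obtain tq where tq: "\<forall>i\<in>K. \<forall>u\<in>part V K i. q \<sim> u \<longrightarrow> i = tq" using rest_type[OF b(2)] by blast
  obtain tr where tr: "\<forall>i\<in>K. \<forall>u\<in>part V K i. r \<sim> u \<longrightarrow> i = tr" using rest_type[OF b(3)] by blast
  obtain k where k: "k \<in> K" "k \<noteq> tp" "k \<noteq> tq" "k \<noteq> tr" by (rule ex_not3[OF K_card])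
  then have "\<not> k \<sim> p" "\<not> k \<sim> q" "\<not> k \<sim> r"
    using tp tq tr self_in_part[OF k(1)] adj_sym by blast+
  moreover have "p \<in> V" "q \<in> V" "r \<in> V" "k \<in> V" using b k K_sub by auto
  ultimately show False using P3_K1_freeD[of p q r k] a by blast
qed

text \<open>Two missed vertices of a part, joined through a vertex \<open>k\<close> of
  \<open>K\<close> that \<open>b\<close> does not see, form a path missed by
  \<open>b\<close>.\<close>

lemma rest_misses_at_most_one:
  assumes b: "b \<in> rest V K" and i: "i \<in> K"
    and u: "u \<in> part V K i" "\<not> b \<sim> u" and w: "w \<in> part V K i" "\<not> b \<sim> w"
  shows "u = w"
proof (rule ccontr)
  assume "u \<noteq> w"
  obtain t where t: "\<forall>i\<in>K. \<forall>u\<in>part V K i. b \<sim> u \<longrightarrow> i = t" using rest_type[OF b] by blast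
  obtain k where k: "k \<in> K" "k \<noteq> i" "k \<noteq> t" by (rule ex_not3[OF K_card])
  have "u \<sim> k" "k \<sim> w" using part_adj_K[OF u(1) k(1,2)] part_adj_K[OF w(1) k(1,2)] adj_sym by auto
  moreover have "\<not> b \<sim> k" using t k self_in_part[OF k(1)] by blast
  moreover have "\<not> u \<sim> w" using part_independent[OF i u(1) w(1)] .
  moreover have "u \<in> V" "k \<in> V" "w \<in> V" "b \<in> V"
    using mem_V(1)[OF b] mem_V(2)[OF u(1)] mem_V(2)[OF w(1)] mem_V(3)[OF k(1)] by simp_all
  ultimately show False using P3_K1_freeD[of u k w b] \<open>u \<noteq> w\<close> u(2) w(2) by blast
qed

text \<open>Otherwise \<open>c\<close> misses the induced path \<open>b - u - k\<close> for a
  suitable \<open>k\<close> in \<open>K\<close>.\<close>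

lemma rest_nonadjacent_same_core_neighbours:
  assumes b: "b \<in> rest V K" "c \<in> rest V K" "\<not> b \<sim> c" and i: "i \<in> K"
    and u: "u \<in> part V K i" "b \<sim> u"
  shows "c \<sim> u"
proof (rule ccontr)
  assume "\<not> c \<sim> u"
  obtain t where t: "\<forall>i\<in>K. \<forall>u\<in>part V K i. c \<sim> u \<longrightarrow> i = t" using rest_type[OF b(2)] by blast
  obtain k where k: "k \<in> K" "k \<noteq> i" "k \<noteq> t" by (rule ex_not3[OF K_card])
  have "\<not> c \<sim> k" using t k self_in_part[OF k(1)] by blast
  moreover have "u \<sim> k" using part_adj_K[OF u(1) k(1,2)] .
  moreover have "\<not> b \<sim> k"
    using rest_one_part[OF b(1) i k(1) u(1) self_in_part[OF k(1)] u(2)] k(2) by blast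
  moreover have "b \<noteq> k" using b k K_sub_core by blast
  moreover have "u \<in> V" "k \<in> V" "c \<in> V" "b \<in> V"
    using mem_V(1)[OF b(1)] mem_V(1)[OF b(2)] mem_V(2)[OF u(1)] mem_V(3)[OF k(1)] by simp_all
  moreover have "\<not> c \<sim> b" using b(3) adj_sym by blast
  ultimately show False using P3_K1_freeD[of b u k c] \<open>\<not> c \<sim> u\<close> u(2) by blast
qed

text \<open>Here \<open>rest\<close> is a union of at least two cliques. Nonadjacent vertices agree
  on the core, and adjacent ones agree through a vertex of another clique, so all of
  \<open>rest\<close> sees the same core vertices, in at most one part \<open>i\<close>. If some
  \<open>u\<close> in it is seen, \<open>u\<close> extends every clique of \<open>rest\<close>, so
  these have fewer than \<open>card K\<close> vertices and the colours \<open>K - {i}\<close>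
  suffice.\<close>

lemma colourable_rest_not_complete:
  assumes "\<not> complete_on (rest V K)"
  shows "colourable V (card K)"
proof -
  let ?B = "rest V K"
  obtain b c where bc: "b \<in> ?B" "c \<in> ?B" "b \<noteq> c" "\<not> b \<sim> c"
    using assms by (auto simp: complete_on_def)
  have finB: "finite ?B" using finite_V by simp
  have same: "b \<sim> u" if d: "d \<in> ?B" "i \<in> K" "u \<in> part V K i" "d \<sim> u" for d i u
  proof (cases "d \<sim> b")
    case False
    then show ?thesis using rest_nonadjacent_same_core_neighbours[OF d(1) bc(1) _ d(2-4)] by blast
  next
    case True
    then have "\<not> d \<sim> c" using rest_P3_free bc d(1) adj_sym unfolding P3_free_def by blast
    then have "c \<sim> u" using rest_nonadjacent_same_core_neighbours[OF d(1) bc(2) _ d(2-4)] by blast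
    then show ?thesis
      using rest_nonadjacent_same_core_neighbours[OF bc(2,1) _ d(2,3)] bc(4) adj_sym by blast
  qed
  have same': "d \<sim> u" if d: "d \<in> ?B" "i \<in> K" "u \<in> part V K i" "b \<sim> u" for d i u
  proof (cases "b \<sim> d")
    case False
    then show ?thesis using rest_nonadjacent_same_core_neighbours[OF bc(1) d(1) _ d(2-4)] by blast
  next
    case True
    then have "\<not> d \<sim> c" using rest_P3_free bc d(1) unfolding P3_free_def by blast
    then have "\<not> c \<sim> d" using adj_sym by blast
    have "c \<sim> u" using rest_nonadjacent_same_core_neighbours[OF bc(1,2,4) d(2-4)] .
    then show ?thesis
      using rest_nonadjacent_same_core_neighbours[OF bc(2) d(1) \<open>\<not> c \<sim> d\<close> d(2,3)] by blast
  qed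
  have "\<exists>C\<subseteq>K. colourable ?B (card C) \<and> (\<forall>i\<in>C. \<forall>d\<in>?B. \<forall>u\<in>part V K i. \<not> d \<sim> u)"
  proof (cases "\<exists>i\<in>K. \<exists>u\<in>part V K i. b \<sim> u")
    case True
    then obtain i u where iu: "i \<in> K" "u \<in> part V K i" "b \<sim> u" by blast
    have "card Q \<le> card (K - {i})" if Q: "Q \<subseteq> ?B" "complete_on Q" for Q
    proof -
      have "complete_on (insert u Q)"
        using Q same'[OF _ iu] adj_sym unfolding complete_on_insert by blast
      moreover have "insert u Q \<subseteq> V" using Q(1) mem_V(2)[OF iu(2)] by blast
      ultimately have "card (insert u Q) \<le> card K" using K_max by blast
      moreover have "u \<notin> Q" using Q(1) iu by (auto simp: core_def)
      moreover have "finite Q" using Q(1) finB finite_subset by blast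
      ultimately show ?thesis using iu(1) by simp
    qed
    then have "colourable ?B (card (K - {i}))"
      by (rule colourable_P3_free[OF finB rest_P3_free])
    moreover have "\<not> d \<sim> w" if "j \<in> K - {i}" "d \<in> ?B" "w \<in> part V K j" for j d w
      using rest_one_part[OF bc(1) iu(1) _ iu(2) that(3) iu(3)] same[OF that(2) _ that(3)] that(1) by blast
    ultimately show ?thesis by (intro exI[of _ "K - {i}"]) blast
  next
    case False
    have "colourable ?B (card K)"
      by (rule colourable_P3_free[OF finB rest_P3_free]) (use K_max in auto)
    moreover have "\<not> d \<sim> u" if "i \<in> K" "d \<in> ?B" "u \<in> part V K i" for i d u
      using False same[OF that(2,1,3)] that by blast
    ultimately show ?thesis by blast
  qed
  then obtain C where C: "C \<subseteq> K" "colourable ?B (card C)"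
    and sep: "\<forall>i\<in>C. \<forall>d\<in>?B. \<forall>u\<in>part V K i. \<not> d \<sim> u" by blast
  have "finite C" using C(1) finite_K finite_subset by blast
  obtain h where h: "h ` ?B \<subseteq> C" "proper_on ?B h"
    using colourableE[OF C(2) \<open>finite C\<close> order_refl] .
  show ?thesis
  proof (rule colouring_extend_core[where e = "\<lambda>i. i" and C = K, OF h(2)])
    show "h d \<noteq> i" if "d \<in> ?B" "i \<in> K" "u \<in> part V K i" "d \<sim> u" for d i u
      using that sep h(1) by blast
    show "h ` ?B \<subseteq> K" using h(1) C(1) by blast
  qed (use finite_K in auto)
qed

lemma colourable_from_injective:
  assumes "inj_on g (rest V K)" "g ` rest V K \<subseteq> C" "inj_on e K" "e ` K \<subseteq> C" "finite C" "card C \<le> k"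
    and "\<And>b i u. b \<in> rest V K \<Longrightarrow> i \<in> K \<Longrightarrow> u \<in> part V K i \<Longrightarrow> b \<sim> u \<Longrightarrow> g b \<noteq> e i"
  shows "colourable V k"
proof (rule colouring_extend_core[OF _ assms(3) assms(7) assms(2,4,5,6)])
  show "proper_on (rest V K) g"
    using assms(1) adj_irrefl unfolding proper_on_def inj_on_def by metis
qed

lemma attached_parts:
  assumes "b \<in> rest V K"
  shows "finite {i\<in>K. \<exists>u\<in>part V K i. b \<sim> u} \<and> card {i\<in>K. \<exists>u\<in>part V K i. b \<sim> u} \<le> 1"
proof -
  obtain t where "\<forall>i\<in>K. \<forall>u\<in>part V K i. b \<sim> u \<longrightarrow> i = t" using rest_type[OF assms] by blast
  then have "{i\<in>K. \<exists>u\<in>part V K i. b \<sim> u} \<subseteq> {t}" by blast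
  then show ?thesis using finite_K card_mono[of "{t}"] by auto
qed

text \<open>A complete \<open>rest\<close> has at most \<open>card K\<close> vertices, each
  forbidding one colour, so \<open>card K + 1\<close> colours allow the greedy choice.\<close>

lemma colourable_Suc_card:
  shows "colourable V (card K + 1)"
proof (cases "complete_on (rest V K)")
  case False
  then show ?thesis using colourable_rest_not_complete colourable_mono by simp
next
  case True
  define T where "T b = {i\<in>K. \<exists>u\<in>part V K i. b \<sim> u}" for b
  define C where "C = insert None (Some ` K)"
  have C: "finite C" "card C = card K + 1" using finite_K by (auto simp: C_def card_image)
  have "card (rest V K) + 1 \<le> card C" using K_max[OF _ True] C(2) by simp
  moreover have "\<forall>b\<in>rest V K. finite (Some ` T b) \<and> card (Some ` T b) \<le> 1"
    using attached_parts by (simp add: T_def card_image)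
  moreover have "finite (rest V K)" using finite_V by simp
  ultimately obtain g where g: "inj_on g (rest V K)" "g ` rest V K \<subseteq> C" "\<forall>b\<in>rest V K. g b \<notin> Some ` T b"
    using ex_injective_choice[of "rest V K" C "\<lambda>b. Some ` T b" 1] C(1) by blast
  show ?thesis
    by (rule colourable_from_injective[OF g(1,2), of Some])
      (use g(3) C in \<open>auto simp: C_def T_def\<close>)
qed

lemma rest_all_attached_to_same_part:
  assumes "complete_on (rest V K)" "\<not> colourable V (card K)"
  obtains r where "r \<in> K" "\<And>b. b \<in> rest V K \<Longrightarrow> \<exists>u\<in>part V K r. b \<sim> u" "card (rest V K) = card K"
proof -
  define B where "B = rest V K"
  define T where "T b = {i\<in>K. \<exists>u\<in>part V K i. b \<sim> u}" for b
  have finB: "finite B" using finite_V by (simp add: B_def)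
  have le: "card B \<le> card K" using K_max[OF _ assms(1)] by (simp add: B_def)
  have T1: "finite (T b) \<and> card (T b) \<le> 1" if "b \<in> B" for b
    using attached_parts that by (simp add: T_def B_def)
  have ninj: False if "inj_on g B" "g ` B \<subseteq> K" "\<forall>b\<in>B. g b \<notin> T b" for g
    using colourable_from_injective[of g K "\<lambda>i. i" "card K"] that assms(2) finite_K by (auto simp: T_def B_def)
  have "B \<noteq> {}" using ninj[of "\<lambda>b. b"] by auto
  then obtain b0 where b0: "b0 \<in> B" by blast
  have "card (B - {b0}) + 1 \<le> card K" using le b0 finB card_gt_0_iff[of B] by auto
  moreover have "\<forall>b\<in>B - {b0}. finite (T b) \<and> card (T b) \<le> 1" using T1 by simp
  moreover have "finite (B - {b0})" using finB by simp
  ultimately obtain g where g: "inj_on g (B - {b0})" "g ` (B - {b0}) \<subseteq> K" "\<forall>b\<in>B - {b0}. g b \<notin> T b"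
    using ex_injective_choice[of "B - {b0}" K T 1] finite_K by auto
  have cg: "card (g ` (B - {b0})) = card B - 1" using g(1) b0 finB by (simp add: card_image)
  have "card (K - g ` (B - {b0})) = card K - (card B - 1)"
    using cg g(2) finB by (simp add: card_Diff_subset)
  moreover have "card B \<ge> 1" using b0 finB card_gt_0_iff[of B] by auto
  ultimately have cL: "card (K - g ` (B - {b0})) = Suc (card K - card B)" using le by simp
  then have "K - g ` (B - {b0}) \<noteq> {}" by (metis card.empty nat.distinct(1))
  then obtain r where r: "r \<in> K - g ` (B - {b0})" by blast
  have free: "r' \<in> T b0" if "r' \<in> K - g ` (B - {b0})" for r'
  proof (rule ccontr)
    assume "r' \<notin> T b0"
    have "inj_on (g(b0 := r')) B"
      using g(1) that by (auto simp: inj_on_def)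
    moreover have "(g(b0 := r')) ` B \<subseteq> K" using g(2) that by auto
    moreover have "\<forall>b\<in>B. (g(b0 := r')) b \<notin> T b" using g(3) \<open>r' \<notin> T b0\<close> by simp
    ultimately show False by (rule ninj)
  qed
  then have "card (K - g ` (B - {b0})) \<le> card (T b0)"
    using T1[OF b0] by (intro card_mono) auto
  then have eq: "card B = card K" using cL T1[OF b0] le by linarith
  have T0: "T b0 = {r}" using T1[OF b0] free[OF r] by (auto simp: card_le_Suc0_iff_eq)
  have "r \<in> T b" if b: "b \<in> B" for b
  proof (rule ccontr)
    assume "r \<notin> T b"
    then have "b \<noteq> b0" using T0 by auto
    then have gb: "g b \<in> K" "g b \<noteq> r" using g(2) b r by auto
    define h where "h = g(b0 := g b, b := r)"
    have "inj_on h B"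
      using g(1) r b \<open>b \<noteq> b0\<close> unfolding h_def inj_on_def by (auto split: if_splits)
    moreover have "h ` B \<subseteq> K" using g(2) gb r by (auto simp: h_def)
    moreover have "\<forall>c\<in>B. h c \<notin> T c" using g(3) T0 gb \<open>r \<notin> T b\<close> \<open>b \<noteq> b0\<close> by (auto simp: h_def)
    ultimately show False using ninj by blast
  qed
  then show thesis using that[of r] r eq by (auto simp: T_def B_def)
qed

text \<open>By maximality each vertex of part \<open>r\<close> misses some vertex of
  \<open>rest\<close>, and each vertex of \<open>rest\<close> misses at most one vertex of the part.
  This forces the part to be \<open>{x, y}\<close>, where \<open>x\<close> misses only
  \<open>z\<close> and \<open>y\<close> sees only \<open>z\<close>. The two sides are
  \<open>K - {r}\<close> and \<open>rest V K - {z}\<close>.\<close>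

lemma hajos_if_rest_complete:
  assumes "complete_on (rest V K)" "\<not> colourable V (card K)"
  shows "\<exists>x y z Q R. hajos V (card K - 1) x y z Q R"
proof -
  let ?B = "rest V K"
  obtain r where r: "r \<in> K" and att: "\<And>b. b \<in> ?B \<Longrightarrow> \<exists>u\<in>part V K r. b \<sim> u" and cB: "card ?B = card K"
    using rest_all_attached_to_same_part[OF assms] by metis
  have B4: "4 \<le> card ?B" using cB K_card by simp
  have finB: "finite ?B" using finite_V by simp
  have coreB: "u \<notin> ?B" if "u \<in> part V K r" for u using that r by (auto simp: core_def)
  have misses: "\<exists>b\<in>?B. \<not> u \<sim> b" if u: "u \<in> part V K r" for u
  proof (rule ccontr)
    assume "\<not> ?thesis"
    then have "complete_on (insert u ?B)" using assms(1) by (auto simp: complete_on_insert)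
    moreover have "insert u ?B \<subseteq> V" using mem_V(2)[OF u] by auto
    ultimately have "card (insert u ?B) \<le> card K" using K_max by blast
    then show False using coreB[OF u] finB cB by simp
  qed
  have one: "u = w" if "b \<in> ?B" "u \<in> part V K r" "w \<in> part V K r" "\<not> u \<sim> b" "\<not> w \<sim> b" for b u w
    using rest_misses_at_most_one[OF that(1) r that(2) _ that(3)] that(4,5) adj_sym by blast
  have dichotomy: "a = b" if "u \<in> part V K r" "p \<in> ?B" "q \<in> ?B" "u \<sim> p" "u \<sim> q" "p \<noteq> q"
    "a \<in> ?B" "b \<in> ?B" "\<not> u \<sim> a" "\<not> u \<sim> b" for u p q a b
    using K5_minus_P3_freeD[OF K5_minus_P3_free _ assms(1) mem_V(2)[OF that(1)] that(2-10)] by blast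
  obtain b where "b \<in> ?B" "\<not> r \<sim> b" using misses[OF self_in_part[OF r]] by blast
  moreover obtain u where "u \<in> part V K r" "b \<sim> u" using att \<open>b \<in> ?B\<close> by blast
  ultimately have u: "u \<in> part V K r" "u \<noteq> r" using adj_sym by blast+
  \<comment> \<open>No vertex of \<open>rest\<close> misses both \<open>u\<close> and
    \<open>r\<close>, and there are at least four, so one of the two sees at least two of
    them.\<close>
  have "\<exists>x\<in>{u, r}. \<exists>p\<in>?B. \<exists>q\<in>?B. x \<sim> p \<and> x \<sim> q \<and> p \<noteq> q"
  proof (rule ccontr)
    assume neg: "\<not> ?thesis"
    have "\<exists>p. \<forall>b\<in>?B. u \<sim> b \<longrightarrow> b = p" "\<exists>p. \<forall>b\<in>?B. r \<sim> b \<longrightarrow> b = p"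
      using neg by blast+
    then obtain p q where pq: "\<forall>b\<in>?B. u \<sim> b \<longrightarrow> b = p" "\<forall>b\<in>?B. r \<sim> b \<longrightarrow> b = q" by blast
    obtain b where "b \<in> ?B" "b \<noteq> p" "b \<noteq> q" by (rule ex_not3[OF B4])
    then show False using one[of b u r] pq u self_in_part[OF r] by blast
  qed
  then obtain x p q where x: "x \<in> {u, r}" and pq: "p \<in> ?B" "q \<in> ?B" "x \<sim> p" "x \<sim> q" "p \<noteq> q"
    by blast
  obtain y where "y \<in> {u, r}" "y \<noteq> x" using x u(2) by blast
  then have xy: "x \<in> part V K r" "y \<in> part V K r" "x \<noteq> y" using x u(1) self_in_part[OF r] by auto
  obtain z where z: "z \<in> ?B" "\<not> x \<sim> z" using misses[OF xy(1)] by blast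
  have xB: "x \<sim> b" if "b \<in> ?B" "b \<noteq> z" for b
    using dichotomy[OF xy(1) pq that(1) z(1)] z(2) that(2) by blast
  have yz: "y \<sim> z" using one[OF z(1) xy(1,2) z(2)] xy(3) by blast
  \<comment> \<open>With a second neighbour, \<open>y\<close> would miss only one vertex
    \<open>c\<close> of \<open>rest\<close>; then in the clique \<open>insert x (?B - {z})\<close>
    it sees \<open>s\<close>, \<open>t\<close> but misses \<open>x\<close> and
    \<open>c\<close>.\<close>
  have yB: "\<not> y \<sim> b" if b: "b \<in> ?B" "b \<noteq> z" for b
  proof
    assume "y \<sim> b"
    obtain c where c: "c \<in> ?B" "\<not> y \<sim> c" using misses[OF xy(2)] by blast
    then have "c \<noteq> z" using yz by blast
    have yb: "y \<sim> d" if "d \<in> ?B" "d \<noteq> c" for d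
      using dichotomy[OF xy(2) b(1) z(1) \<open>y \<sim> b\<close> yz b(2) that(1) c(1)] c(2) that(2) by blast
    obtain s where s: "s \<in> ?B" "s \<noteq> z" "s \<noteq> c" by (rule ex_not3[OF B4])
    obtain t where t: "t \<in> ?B" "t \<noteq> z" "t \<noteq> c" "t \<noteq> s" by (rule ex_not3[OF B4])
    have "complete_on (insert x (?B - {z}))"
      using complete_on_subset[OF assms(1)] xB by (auto simp: complete_on_insert)
    moreover have "insert x (?B - {z}) \<subseteq> V" using mem_V(2)[OF xy(1)] by auto
    moreover have "\<not> y \<sim> x" using part_independent[OF r xy(2,1)] .
    ultimately have "x = c"
      using K5_minus_P3_freeD[OF K5_minus_P3_free, of "insert x (?B - {z})" y s t x c]
        mem_V(2)[OF xy(2)] s t yb[of s] yb[of t] c \<open>c \<noteq> z\<close> by simp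
    then show False using coreB[OF xy(1)] c(1) by blast
  qed
  have part_r: "part V K r = {x, y}"
  proof -
    have "w = x \<or> w = y" if w: "w \<in> part V K r" for w
    proof (rule ccontr)
      assume "\<not> ?thesis"
      then have ne: "w \<noteq> x" "w \<noteq> y" by auto
      obtain b where b: "b \<in> ?B" "\<not> w \<sim> b" using misses[OF w] by blast
      show False
      proof (cases "b = z")
        case True
        then show False using one[OF z(1) w xy(1)] b z ne by blast
      next
        case False
        then show False using one[OF b(1) w xy(2) b(2) yB] b(1) ne by blast
      qed
    qed
    then show ?thesis using xy by blast
  qed
  have KB: "\<not> b \<sim> u" if "b \<in> ?B" "j \<in> K" "j \<noteq> r" "u \<in> part V K j" for b j u
    using att[OF that(1)] rest_one_part[OF that(1) r that(2) _ that(4)] that(3) by blast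
  \<comment> \<open>All of \<open>rest\<close> is attached to part \<open>r\<close>, so
    \<open>z\<close> misses every other part completely, and it can miss only one vertex of
    each.\<close>
  have part_j: "part V K j = {j}" if j: "j \<in> K" "j \<noteq> r" for j
  proof -
    have "w = j" if "w \<in> part V K j" for w
      using rest_misses_at_most_one[OF z(1) j(1) that _ self_in_part[OF j(1)]]
        KB[OF z(1) j that] KB[OF z(1) j self_in_part[OF j(1)]] by blast
    then show ?thesis using self_in_part[OF j(1)] by blast
  qed
  have "core V K = (K - {r}) \<union> {x, y}"
  proof -
    have "core V K = part V K r \<union> (\<Union>j\<in>K - {r}. part V K j)" using r by (auto simp: core_def)
    then show ?thesis using part_r part_j by auto
  qed
  moreover have "core V K \<subseteq> V" using part_sub by (auto simp: core_def)
  ultimately have V: "V = (K - {r}) \<union> (?B - {z}) \<union> {x, y, z}" using z by blast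
  have yr: "complete_on (insert y (K - {r}))" "complete_on (insert x (K - {r}))"
    using complete_exchange[OF r] xy by auto
  have nin: "y \<notin> K - {r}" "x \<notin> K - {r}"
    using xy part_unique[OF _ self_in_part] r by blast+
  have zB: "insert z (?B - {z}) = ?B" using z by blast
  have xR: "complete_on (insert x (?B - {z}))"
    using complete_on_subset[OF assms(1)] xB by (auto simp: complete_on_insert)
  have nB: "x \<notin> ?B" "y \<notin> ?B" using coreB xy by blast+
  have "z \<notin> K" using z K_sub_core by blast
  then have out: "x \<notin> (K - {r}) \<union> (?B - {z})" "y \<notin> (K - {r}) \<union> (?B - {z})" "z \<notin> (K - {r}) \<union> (?B - {z})"
    using nin nB by simp_all
  have QB: "\<not> b \<sim> q" "\<not> q \<sim> b" if "q \<in> K - {r}" "b \<in> ?B" for q b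
    using KB[OF that(2), of q q] self_in_part[of q] that(1) adj_sym by blast+
  have card: "card (K - {r}) = card K - 1" "card (?B - {z}) = card K - 1"
    using z(1) cB finB r finite_K by simp_all
  have nxy: "\<not> x \<sim> y" using part_independent[OF r xy(1,2)] .
  have "x \<noteq> z" using nB z by blast
  have "hajos V (card K - 1) x y z (K - {r}) (?B - {z})"
    unfolding hajos_def zB
  proof (intro conjI)
    show "V = K - {r} \<union> (?B - {z}) \<union> {x, y, z}" by (rule V)
    show "\<forall>q\<in>K - {r}. \<forall>b\<in>?B - {z}. \<not> q \<sim> b" using QB(2) by simp
    show "\<forall>q\<in>K - {r}. \<not> z \<sim> q" using QB(1) z(1) by simp
    show "\<forall>b\<in>?B - {z}. \<not> y \<sim> b" using yB by simp
  qed (fact yr xR assms(1) out card xy(3) yz nxy z(2) \<open>x \<noteq> z\<close>)+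
  then show ?thesis by blast
qed

end

section \<open>The extremal argument\<close>

text \<open>The counterexample together with one maximum clique; by
  \<open>uncolourable_exchange\<close> everything proved here holds for every other maximum clique
  as well.\<close>

locale uncolourable = max_clique_P3_2K1_free +
  assumes uncolourable: "\<not> colourable V (card K + 1)"
begin

text \<open>\<open>rest\<close> is not \<open>card K\<close>-colourable. Hence its maximum clique
  \<open>Q\<close> has at least four vertices, and even \<open>card K\<close>, since
  \<open>card Q + 1\<close> colours suffice for \<open>rest\<close>. What then remains is the case
  of a complete \<open>rest\<close> of \<open>rest\<close>.\<close>

lemma rest_hajos: "\<exists>x y z Q R. hajos (rest V K) (card K - 1) x y z Q R"
proof -
  let ?B = "rest V K"
  have ncol: "\<not> colourable ?B (card K)" using colourable_from_rest uncolourable by blast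
  have finB: "finite ?B" using finite_V by simp
  obtain Q where Q: "Q \<subseteq> ?B" "complete_on Q" and max: "\<forall>L\<subseteq>?B. complete_on L \<longrightarrow> card L \<le> card Q"
    using max_complete_set[OF finB] by blast
  have QK: "card Q \<le> card K" using K_max[of Q] Q by blast
  have "\<not> card Q \<le> 3"
  proof
    assume "card Q \<le> 3"
    then have "card L \<le> 3" if "L \<subseteq> ?B" "complete_on L" for L
      using max[rule_format, OF that] by linarith
    then have "colourable ?B 4"
      by (rule colourable_4_of_K4_free[OF finB rest_P3_K1_free])
    then show False using ncol K_card colourable_mono by blast
  qed
  then interpret Q: max_clique_P3_K1_free adj ?B Q
    using finB Q max rest_P3_K1_free K5_minus_P3_free_subset[OF K5_minus_P3_free, of ?B]
    by unfold_locales auto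
  have "card Q = card K"
  proof (rule ccontr)
    assume "card Q \<noteq> card K"
    then have "card Q + 1 \<le> card K" using QK by simp
    then show False using colourable_mono[OF Q.colourable_Suc_card] ncol by blast
  qed
  then have n: "\<not> colourable ?B (card Q)" using ncol by simp
  then have "complete_on (rest ?B Q)" using Q.colourable_rest_not_complete by blast
  then show ?thesis using Q.hajos_if_rest_complete[OF _ n] \<open>card Q = card K\<close> by simp
qed

text \<open>A vertex of \<open>rest\<close> sees at most one of the pairs \<open>{u, u'}\<close> and
  \<open>{w, w'}\<close>, while two nonadjacent ones together see both. So nonadjacency in
  \<open>rest\<close> is properly 2-coloured by the pair seen, which is impossible on the 5-cycle of
  non-edges \<open>x, y, r, q, z\<close>.\<close>

lemma one_nontrivial_part:
  assumes i: "i \<in> K" "u \<in> part V K i" "u' \<in> part V K i" "u \<noteq> u'"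
    and j: "j \<in> K" "w \<in> part V K j" "w' \<in> part V K j" "w \<noteq> w'"
  shows "i = j"
proof (rule ccontr)
  assume "i \<noteq> j"
  obtain x y z Q R where H: "hajos (rest V K) (card K - 1) x y z Q R" using rest_hajos by blast
  have n: "3 \<le> card K - 1" "2 \<le> card K - 1" using K_card by auto
  note D = hajosD[OF H n(2)]
  obtain q where q: "q \<in> Q" using D(7) n by fastforce
  obtain r where r: "r \<in> R" using D(8) n by fastforce
  define ti where "ti b \<longleftrightarrow> b \<sim> u \<or> b \<sim> u'" for b
  define tj where "tj b \<longleftrightarrow> b \<sim> w \<or> b \<sim> w'" for b
  have excl: "\<not> (ti b \<and> tj b)" if b: "b \<in> rest V K" for b
    using rest_one_part[OF b i(1) j(1)] i(2,3) j(2,3) \<open>i \<noteq> j\<close> unfolding ti_def tj_def by blast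
  have pair: "(ti b \<or> ti c) \<and> (tj b \<or> tj c)" if "b \<in> rest V K" "c \<in> rest V K" "b \<noteq> c" "\<not> b \<sim> c" for b c
    using part_pair_nonneighbours_clique[OF i(1-4) that(1,2)] part_pair_nonneighbours_clique[OF j(1-4) that(1,2)]
      that(3,4) unfolding ti_def tj_def by blast
  have B: "x \<in> rest V K" "y \<in> rest V K" "z \<in> rest V K" "q \<in> rest V K" "r \<in> rest V K"
    unfolding D(1) using q r by blast+
  have "x \<sim> q" using D(3,9) q by (auto simp: complete_on_insert)
  then have "z \<noteq> q" using D(17) by auto
  have "x \<sim> r" using D(5,11) r by (auto simp: complete_on_insert)
  then have "y \<noteq> r" using D(16) by auto
  have "q \<noteq> r" using D(2) q r by auto
  note ne = \<open>y \<noteq> r\<close> \<open>z \<noteq> q\<close> \<open>q \<noteq> r\<close>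
  have "\<not> q \<sim> z" using D(19)[OF q] adj_sym by blast
  then show False
    using pair[OF B(1,2) D(13,16)] pair[OF B(2,5) ne(1) D(20)[OF r]] pair[OF B(4,5) ne(3) D(18)[OF q r]]
      pair[OF B(3,4) ne(2) D(19)[OF q]] pair[OF B(1,3) D(14,17)]
      excl[OF B(1)] excl[OF B(2)] excl[OF B(3)] excl[OF B(4)] excl[OF B(5)]
    by metis
qed

lemma uncolourable_exchange:
  assumes "L \<subseteq> V" "complete_on L" "card L = card K"
  shows "uncolourable adj V L"
  using assms K_card K_max uncolourable finite_V K5_minus_P3_free P3_2K1_free adj_sym adj_irrefl
  by unfold_locales auto

section \<open>Comparing K with the maximum cliques outside its core\<close>

text \<open>\<open>L\<close> is a maximum clique whose part at \<open>x\<close> is nontrivial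
  because of \<open>y\<close>, so all its other parts are trivial. A core vertex of \<open>K\<close>
  is not in \<open>L\<close>, hence it lies in the part at \<open>x\<close> (it is then called
  attached) or outside the core of \<open>L\<close>. The existential over \<open>p\<close> says that
  there is at most one neighbour.\<close>

lemma hajos_attachment:
  assumes H: "hajos (rest V K) (card K - 1) x y z Q R" and a: "a \<in> core V K"
  defines "L \<equiv> insert x Q"
  shows "uncolourable adj V L" "x \<in> part V L x" "y \<in> part V L x"
    "a \<in> part V L x \<or> (\<exists>p. \<forall>q\<in>L. a \<sim> q \<longrightarrow> q = p) \<and> (\<exists>p. \<forall>q\<in>insert y Q. a \<sim> q \<longrightarrow> q = p)"
proof -
  have n: "3 \<le> card K - 1" "2 \<le> card K - 1" using K_card by auto
  note D = hajosD[OF H n(2)]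
  have sub: "insert x (insert y Q) \<subseteq> rest V K" unfolding D(1) by blast
  have "finite Q" using sub finite_V by (meson finite_Diff finite_insert finite_subset)
  then have "card L = card K" using D(7,9) n by (simp add: L_def)
  then show unc: "uncolourable adj V L"
    using uncolourable_exchange[of L] D(3) sub by (auto simp: L_def)
  interpret L: uncolourable adj V L by (rule unc)
  show xL: "x \<in> part V L x" using L.self_in_part by (simp add: L_def)
  show yL: "y \<in> part V L x"
    using sub D(4,10,16) adj_sym by (auto simp: part_def L_def complete_on_insert)
  show "a \<in> part V L x \<or> (\<exists>p. \<forall>q\<in>L. a \<sim> q \<longrightarrow> q = p) \<and> (\<exists>p. \<forall>q\<in>insert y Q. a \<sim> q \<longrightarrow> q = p)"
  proof (cases "a \<in> core V L")
    case True
    then obtain j where j: "j \<in> L" "a \<in> part V L j" by (auto simp: core_def)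
    have "L \<subseteq> rest V K" using sub by (auto simp: L_def)
    then have "a \<noteq> j" using j(1) a by blast
    then have "x = j"
      using L.one_nontrivial_part[OF _ xL yL D(13) j(1,2) L.self_in_part[OF j(1)]] by (simp add: L_def)
    then show ?thesis using j(2) by blast
  next
    case False
    have "a \<in> V" using a part_sub by (auto simp: core_def)
    then have rL: "a \<in> rest V L" using False by blast
    have 1: "q = q'" if "q \<in> L" "q' \<in> L" "a \<sim> q" "a \<sim> q'" for q q'
      using L.rest_at_most_one_in_K[OF rL] that by blast
    have 2: "False" if "q \<in> Q" "a \<sim> q" "a \<sim> y" for q
      using L.rest_one_part[OF rL _ _ L.self_in_part yL that(2,3)] that(1) D(9) by (auto simp: L_def)
    have "\<exists>p. \<forall>q\<in>L. a \<sim> q \<longrightarrow> q = p" using 1 by blast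
    moreover have "\<exists>p. \<forall>q\<in>insert y Q. a \<sim> q \<longrightarrow> q = p"
      using 1 2 unfolding L_def by (metis insert_iff)
    ultimately show ?thesis by blast
  qed
qed


text \<open>One attached vertex already gives some maximum clique a part with three elements, which
  feeds the extremal choice of \<open>K\<close>.\<close>

lemma hajos_attached_vertex:
  assumes H: "hajos (rest V K) (card K - 1) x y z Q R" and i: "i \<in> K" and a: "a \<in> part V K i"
    and att: "a \<in> part V (insert x Q) x"
  shows "\<not> a \<sim> x" "\<not> a \<sim> y" "\<And>q. q \<in> Q \<Longrightarrow> a \<sim> q" "{x, y, a} \<subseteq> part V (insert x Q) x" "card {x, y, a} = 3"
proof -
  have n: "2 \<le> card K - 1" using K_card by auto
  note D = hajosD[OF H n]
  have aK: "a \<in> core V K" using i a by (auto simp: core_def)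
  note L = hajos_attachment[OF H aK]
  interpret L: uncolourable adj V "insert x Q" by (rule L(1))
  show "\<not> a \<sim> x" "\<not> a \<sim> y" using L.part_independent[OF _ att] L(2,3) by simp_all
  show "a \<sim> q" if "q \<in> Q" for q
    using L.part_adj_K[OF att, of q] that D(9) by auto
  show "{x, y, a} \<subseteq> part V (insert x Q) x" using L(2,3) att by simp
  have "x \<in> rest V K" "y \<in> rest V K" unfolding D(1) by simp_all
  then have "a \<noteq> x" "a \<noteq> y" using aK by auto
  then show "card {x, y, a} = 3" using D(13) by auto
qed

text \<open>The nonadjacent vertices \<open>x\<close> and \<open>y\<close> would both miss
  \<open>a\<close> and \<open>a'\<close>, against
  \<open>part_pair_nonneighbours_clique\<close>.\<close>

lemma hajos_attached_unique:
  assumes H: "hajos (rest V K) (card K - 1) x y z Q R" and i: "i \<in> K"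
    and "a \<in> part V K i" "a' \<in> part V K i" "a \<in> part V (insert x Q) x" "a' \<in> part V (insert x Q) x"
  shows "a = a'"
proof (rule ccontr)
  assume "a \<noteq> a'"
  have n: "2 \<le> card K - 1" using K_card by auto
  note D = hajosD[OF H n]
  have "x \<in> rest V K" "y \<in> rest V K" unfolding D(1) by simp_all
  moreover have "\<not> x \<sim> a" "\<not> x \<sim> a'" "\<not> y \<sim> a" "\<not> y \<sim> a'"
    using hajos_attached_vertex(1,2)[OF H i assms(3,5)] hajos_attached_vertex(1,2)[OF H i assms(4,6)] adj_sym
    by blast+
  ultimately have "x \<sim> y"
    using part_pair_nonneighbours_clique[OF i assms(3,4) \<open>a \<noteq> a'\<close>] D(13) by blast
  then show False using D(16) by blast
qed

text \<open>Each of the two has at most one neighbour in \<open>Q\<close>, and \<open>Q\<close> has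
  at least three vertices.\<close>

lemma hajos_common_nonneighbour:
  assumes H: "hajos (rest V K) (card K - 1) x y z Q R" and i: "i \<in> K"
    and a: "a \<in> part V K i" "a' \<in> part V K i" "a \<notin> part V (insert x Q) x" "a' \<notin> part V (insert x Q) x"
  obtains q where "q \<in> Q" "\<not> q \<sim> a" "\<not> q \<sim> a'"
proof -
  have n: "2 \<le> card K - 1" using K_card by auto
  note D = hajosD[OF H n]
  have aK: "a \<in> core V K" "a' \<in> core V K" using i a by (auto simp: core_def)
  obtain p where p: "\<forall>q\<in>insert x Q. a \<sim> q \<longrightarrow> q = p"
    using hajos_attachment(4)[OF H aK(1)] a(3) by blast
  obtain p' where p': "\<forall>q\<in>insert x Q. a' \<sim> q \<longrightarrow> q = p'"
    using hajos_attachment(4)[OF H aK(2)] a(4) by blast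
  have "3 \<le> card Q" using D(7) K_card by simp
  then obtain q where "q \<in> Q" "q \<noteq> p" "q \<noteq> p'" by (rule ex_not2)
  then show thesis using that[of q] p p' adj_sym by blast
qed

text \<open>Some \<open>r\<close> in \<open>R\<close> misses both \<open>a\<close> and
  \<open>a'\<close>. As \<open>y\<close> misses \<open>r\<close> and \<open>a\<close>, it cannot
  miss \<open>a'\<close> too.\<close>

lemma hajos_unattached_adj:
  assumes H: "hajos (rest V K) (card K - 1) x y z Q R" and i: "i \<in> K"
    and a: "a \<in> part V K i" "a' \<in> part V K i" "a \<noteq> a'"
    and "a \<in> part V (insert x Q) x" "a \<notin> part V (insert x R) x" "a' \<notin> part V (insert x R) x"
  shows "y \<sim> a'"
proof (rule ccontr)
  assume ny: "\<not> y \<sim> a'"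
  have n: "2 \<le> card K - 1" using K_card by auto
  note D = hajosD[OF H n]
  obtain r where r: "r \<in> R" "\<not> r \<sim> a" "\<not> r \<sim> a'"
    using hajos_common_nonneighbour[OF hajos_sym[OF H] i a(1,2) assms(7,8)] by blast
  have "\<not> y \<sim> a" using hajos_attached_vertex(2)[OF H i a(1) assms(6)] adj_sym by blast
  moreover have "y \<in> rest V K" "r \<in> rest V K" unfolding D(1) using r(1) by simp_all
  moreover have "x \<sim> r" using D(5,11) r by (auto simp: complete_on_insert)
  then have "y \<noteq> r" using D(16) by auto
  ultimately have "y \<sim> r"
    using part_pair_nonneighbours_clique[OF i a] ny r(2,3) by blast
  then show False using D(20)[OF r(1)] by blast
qed

text \<open>Otherwise there are \<open>q\<close> in \<open>Q\<close> and \<open>r\<close> in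
  \<open>R\<close> that both miss \<open>a\<close> and \<open>a'\<close>, although they are not
  adjacent.\<close>

lemma hajos_one_attached:
  assumes H: "hajos (rest V K) (card K - 1) x y z Q R" and i: "i \<in> K"
    and a: "a \<in> part V K i" "a' \<in> part V K i" "a \<noteq> a'"
  shows "a \<in> part V (insert x Q) x \<or> a \<in> part V (insert x R) x \<or>
    a' \<in> part V (insert x Q) x \<or> a' \<in> part V (insert x R) x"
proof (rule ccontr)
  assume neg: "\<not> ?thesis"
  have n: "2 \<le> card K - 1" using K_card by auto
  note D = hajosD[OF H n]
  obtain r where r: "r \<in> R" "\<not> r \<sim> a" "\<not> r \<sim> a'"
    using hajos_common_nonneighbour[OF hajos_sym[OF H] i a(1,2)] neg by blast
  obtain q where q: "q \<in> Q" "\<not> q \<sim> a" "\<not> q \<sim> a'"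
    using hajos_common_nonneighbour[OF H i a(1,2)] neg by blast
  have "q \<in> rest V K" "r \<in> rest V K" unfolding D(1) using r(1) q(1) by simp_all
  moreover have "q \<noteq> r" using D(2) q(1) r(1) by blast
  ultimately have "q \<sim> r"
    using part_pair_nonneighbours_clique[OF i a] q(2,3) r(2,3) by blast
  then show False using D(18) q(1) r(1) by blast
qed

text \<open>In the remaining case the graph consists of three disjoint cliques \<open>insert y Q\<close>,
  \<open>insert z R\<close> and \<open>insert a'' (K - {i})\<close> of size \<open>card K\<close>, joined only by the triangle
  \<open>y, z, a''\<close>, and of the independent set \<open>{x, a, a'}\<close>, which takes the extra colour.\<close>

lemma hajos_three_attached:
  assumes H: "hajos (rest V K) (card K - 1) x y z Q R" and i: "i \<in> K"
    and P: "part V K i = {a, a', a''}" "a \<noteq> a'" "a \<noteq> a''" "a' \<noteq> a''"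
    and a: "a \<in> part V (insert x Q) x" "a \<notin> part V (insert x R) x"
    and a': "a' \<in> part V (insert x R) x" "a' \<notin> part V (insert x Q) x"
    and a'': "a'' \<notin> part V (insert x Q) x" "a'' \<notin> part V (insert x R) x"
  shows False
proof -
  have n: "2 \<le> card K - 1" using K_card by auto
  note H' = hajos_sym[OF H]
  note D = hajosD[OF H n]
  have inP: "a \<in> part V K i" "a' \<in> part V K i" "a'' \<in> part V K i" using P(1) by simp_all
  have Pc: "a'' \<in> core V K" using inP(3) i by (auto simp: core_def)
  note aD = hajos_attached_vertex[OF H i inP(1) a(1)]
  note a'D = hajos_attached_vertex[OF H' i inP(2) a'(1)]
  have rest: "x \<in> rest V K" "y \<in> rest V K" "z \<in> rest V K" "\<And>q. q \<in> Q \<Longrightarrow> q \<in> rest V K"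
    "\<And>r. r \<in> R \<Longrightarrow> r \<in> rest V K" unfolding D(1) by simp_all
  have ya'': "y \<sim> a''" using hajos_unattached_adj[OF H i inP(1,3) P(3) a a''(2)] .
  have za'': "z \<sim> a''" using hajos_unattached_adj[OF H' i inP(2,3) P(4) a' a''(1)] .
  \<comment> \<open>\<open>x\<close> misses \<open>a\<close> and \<open>a'\<close>, and
    \<open>y\<close> misses \<open>a\<close>; being nonadjacent, \<open>x\<close> and
    \<open>y\<close> cannot both miss the pair.\<close>
  have ya': "y \<sim> a'"
    using part_pair_nonneighbours_clique[OF i inP(1,2) P(2) rest(1,2)] aD(1,2) a'D(1) D(13,16) adj_sym by blast
  have za: "z \<sim> a"
    using part_pair_nonneighbours_clique[OF i inP(1,2) P(2) rest(1,3)] aD(1) a'D(1,2) D(14,17) adj_sym by blast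
  have "\<exists>p. \<forall>q\<in>insert y Q. a'' \<sim> q \<longrightarrow> q = p" using hajos_attachment(4)[OF H Pc] a''(1) by blast
  then have a''Q: "\<not> q \<sim> a''" if "q \<in> Q" for q using ya'' that D(10) adj_sym by (metis insert_iff)
  have "\<exists>p. \<forall>q\<in>insert z R. a'' \<sim> q \<longrightarrow> q = p" using hajos_attachment(4)[OF H' Pc] a''(2) by blast
  then have a''R: "\<not> r \<sim> a''" if "r \<in> R" for r using za'' that D(12) adj_sym by (metis insert_iff)
  have K_rest: "\<not> b \<sim> k" if "b \<in> rest V K" "u \<in> part V K i" "b \<sim> u" "k \<in> K - {i}" for b u k
    using rest_one_part[OF that(1) i _ that(2) self_in_part that(3)] that(4) by blast
  have QK: "\<not> q \<sim> k" if "q \<in> Q" "k \<in> K - {i}" for q k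
    using K_rest[OF rest(4)[OF that(1)] inP(1) _ that(2)] aD(3)[OF that(1)] adj_sym by blast
  have RK: "\<not> r \<sim> k" if "r \<in> R" "k \<in> K - {i}" for r k
    using K_rest[OF rest(5)[OF that(1)] inP(2) _ that(2)] a'D(3)[OF that(1)] adj_sym by blast
  have yK: "\<not> y \<sim> k" if "k \<in> K - {i}" for k using K_rest[OF rest(2) inP(2) ya' that] .
  have zK: "\<not> z \<sim> k" if "k \<in> K - {i}" for k using K_rest[OF rest(3) inP(1) za that] .
  define C1 where "C1 = insert y Q"
  define C2 where "C2 = insert z R"
  define C3 where "C3 = insert a'' (K - {i})"
  define X where "X = {x, a, a'}"
  have fin: "finite Q" "finite R" using D(7,8) n by (auto intro: card_ge_0_finite)
  have C: "finite C1" "finite C2" "finite C3" "card C1 \<le> card K" "card C2 \<le> card K" "card C3 \<le> card K"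
    using fin finite_K D(7,8,10,12) i n by (auto simp: C1_def C2_def C3_def card_insert_if)
  have comp: "complete_on C1" "complete_on C2" "complete_on C3"
    using D(4,6) complete_exchange[OF i inP(3)] by (simp_all add: C1_def C2_def C3_def)
  have c12: "u = y \<and> v = z" if "u \<in> C1" "v \<in> C2" "u \<sim> v" for u v
    using that D(18-20) adj_sym unfolding C1_def C2_def by blast
  have c13: "u = y \<and> v = a''" if "u \<in> C1" "v \<in> C3" "u \<sim> v" for u v
    using that QK yK a''Q unfolding C1_def C3_def by blast
  have c23: "u = z \<and> v = a''" if "u \<in> C2" "v \<in> C3" "u \<sim> v" for u v
    using that RK zK a''R unfolding C2_def C3_def by blast
  have Xind: "\<not> u \<sim> v" if "u \<in> X" "v \<in> X" for u v
    using that aD(1) a'D(1) part_independent[OF i inP(1,2)] adj_sym adj_irrefl unfolding X_def by blast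
  have "part V K j = {j}" if "j \<in> K" "j \<noteq> i" for j
    using one_nontrivial_part[OF i inP(1,2) P(2) that(1) self_in_part[OF that(1)]] self_in_part[OF that(1)] that(2)
    by blast
  then have "(\<Union>j\<in>K - {i}. part V K j) = K - {i}" by auto
  moreover have "core V K = part V K i \<union> (\<Union>j\<in>K - {i}. part V K j)" using i by (auto simp: core_def)
  moreover have "V = core V K \<union> rest V K" using part_sub by (auto simp: core_def)
  ultimately have V: "V = X \<union> C1 \<union> C2 \<union> C3"
    using D(1) P(1) unfolding X_def C1_def C2_def C3_def by auto
  \<comment> \<open>The colours 0, 1, 2 of \<open>y\<close>, \<open>z\<close>, \<open>a''\<close>
    settle all edges between the three cliques, as these lie in that triangle.\<close>
  obtain f1 :: "'a \<Rightarrow> nat" where f1: "inj_on f1 C1" "f1 ` C1 \<subseteq> {..<card K}" "f1 y = 0"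
    using inj_with_value[OF C(1) _ C(4), of y 0] K_card by (auto simp: C1_def)
  obtain f2 :: "'a \<Rightarrow> nat" where f2: "inj_on f2 C2" "f2 ` C2 \<subseteq> {..<card K}" "f2 z = 1"
    using inj_with_value[OF C(2) _ C(5), of z 1] K_card by (auto simp: C2_def)
  obtain f3 :: "'a \<Rightarrow> nat" where f3: "inj_on f3 C3" "f3 ` C3 \<subseteq> {..<card K}" "f3 a'' = 2"
    using inj_with_value[OF C(3) _ C(6), of a'' 2] K_card by (auto simp: C3_def)
  define c where "c v = (if v \<in> X then card K else if v \<in> C1 then f1 v else if v \<in> C2 then f2 v else f3 v)" for v
  have lt: "c v < card K" if "v \<in> V" "v \<notin> X" for v
    using that f1(2) f2(2) f3(2) unfolding V c_def by auto
  have cls: "v \<in> C1 \<and> c v = f1 v \<or> v \<in> C2 \<and> c v = f2 v \<or> v \<in> C3 \<and> c v = f3 v" if "v \<in> V" "v \<notin> X" for v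
    using that unfolding V c_def by auto
  have inj: "f1 u \<noteq> f1 v" if "u \<in> C1" "v \<in> C1" "u \<sim> v" for u v
    using that f1(1) adj_irrefl by (auto simp: inj_on_def)
  moreover have "f2 u \<noteq> f2 v" if "u \<in> C2" "v \<in> C2" "u \<sim> v" for u v
    using that f2(1) adj_irrefl by (auto simp: inj_on_def)
  moreover have "f3 u \<noteq> f3 v" if "u \<in> C3" "v \<in> C3" "u \<sim> v" for u v
    using that f3(1) adj_irrefl by (auto simp: inj_on_def)
  moreover have "f1 u \<noteq> f2 v" if "u \<in> C1" "v \<in> C2" "u \<sim> v" for u v
    using c12[OF that] f1(3) f2(3) by simp
  moreover have "f1 u \<noteq> f3 v" if "u \<in> C1" "v \<in> C3" "u \<sim> v" for u v
    using c13[OF that] f1(3) f3(3) by simp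
  moreover have "f2 u \<noteq> f3 v" if "u \<in> C2" "v \<in> C3" "u \<sim> v" for u v
    using c23[OF that] f2(3) f3(3) by simp
  ultimately have off_X: "c u \<noteq> c v" if "u \<in> V" "u \<notin> X" "v \<in> V" "v \<notin> X" "u \<sim> v" for u v
    using cls[OF that(1,2)] cls[OF that(3,4)] that(5) adj_sym[OF that(5)] by (elim disjE conjE) metis+
  have "colourable V (card K + 1)"
  proof (rule colourableI[of c V "{..card K}"])
    show "c ` V \<subseteq> {..card K}" using lt by (auto simp: c_def) (metis less_imp_le c_def)+
    show "proper_on V c"
      unfolding proper_on_def
    proof (intro ballI impI)
      fix u v assume uv: "u \<in> V" "v \<in> V" "u \<sim> v"
      have X: "c w = card K" if "w \<in> X" for w using that by (simp add: c_def)
      show "c u \<noteq> c v"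
        using Xind[of u v] X[of u] X[of v] lt[of u] lt[of v] off_X[of u v] uv by (cases "u \<in> X"; cases "v \<in> X") auto
    qed
  qed auto
  then show False using uncolourable by blast
qed

text \<open>The part \<open>{x, y, ...}\<close> of a clique in \<open>rest\<close> forces two
  vertices into part \<open>i\<close>, hence an attached one, hence a third vertex. Since at most
  one vertex is attached on each side and no two are unattached, part \<open>i\<close> has exactly
  one vertex attached on each side and one unattached, which is the excluded case.\<close>

lemma not_largest_part:
  assumes i: "i \<in> K"
    and largest: "\<And>L j. L \<subseteq> V \<Longrightarrow> complete_on L \<Longrightarrow> card L = card K \<Longrightarrow> j \<in> L \<Longrightarrow>
      card (part V L j) \<le> card (part V K i)"
  shows False
proof -
  obtain x y z Q R where H: "hajos (rest V K) (card K - 1) x y z Q R" using rest_hajos by blast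
  note H' = hajos_sym[OF H]
  have n: "2 \<le> card K - 1" using K_card by auto
  note D = hajosD[OF H n]
  have large: "card T \<le> card (part V K i)"
    if H: "hajos (rest V K) (card K - 1) x y z Q R" and T: "T \<subseteq> part V (insert x Q) x" for x y z Q R T
  proof -
    have "i \<in> core V K" using i K_sub_core by blast
    interpret L: uncolourable adj V "insert x Q"
      by (rule hajos_attachment(1)[OF H \<open>i \<in> core V K\<close>])
    note D = hajosD[OF H n]
    have "finite Q" using D(7) n by (auto intro: card_ge_0_finite)
    then have "card (insert x Q) = card K" using D(7,9) n by simp
    then have "card (part V (insert x Q) x) \<le> card (part V K i)"
      using largest[OF L.K_sub L.K_complete] by blast
    then show ?thesis using card_mono[OF L.finite_part T] by simp
  qed
  let ?P = "part V K i"
  let ?att = "\<lambda>a. a \<in> part V (insert x Q) x"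
  let ?att' = "\<lambda>a. a \<in> part V (insert x R) x"
  have iK: "i \<in> core V K" using i K_sub_core by blast
  have "card {x, y} \<le> card ?P"
    using hajos_attachment(2,3)[OF H iK] by (intro large[OF H]) simp
  then have "\<not> card ?P \<le> Suc 0" using D(13) by simp
  then obtain a b where "a \<in> ?P" "b \<in> ?P" "a \<noteq> b"
    unfolding card_le_Suc0_iff_eq[OF finite_part[of i]] by blast
  then obtain a where a: "a \<in> ?P" "?att a \<or> ?att' a"
    using hajos_one_attached[OF H i] by metis
  have P3: "3 \<le> card ?P"
    using a(2)
  proof
    assume "?att a"
    then show ?thesis using large[OF H hajos_attached_vertex(4)[OF H i a(1)]] hajos_attached_vertex(5)[OF H i a(1)] by simp
  next
    assume "?att' a"
    then show ?thesis using large[OF H' hajos_attached_vertex(4)[OF H' i a(1)]] hajos_attached_vertex(5)[OF H' i a(1)] by simp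
  qed
  obtain b where b: "b \<in> ?P" "b \<noteq> a" by (rule ex_not2[OF P3])
  obtain c where c: "c \<in> ?P" "c \<noteq> a" "c \<noteq> b" by (rule ex_not2[OF P3])
  obtain d where d: "d \<in> ?P" "d \<noteq> a" "?att d \<or> ?att' d"
    using hajos_one_attached[OF H i b(1) c(1)] b c by metis
  have uniq: "p = q" if "p \<in> ?P" "q \<in> ?P" "?att p" "?att q" for p q
    using hajos_attached_unique[OF H i that] .
  have uniq': "p = q" if "p \<in> ?P" "q \<in> ?P" "?att' p" "?att' q" for p q
    using hajos_attached_unique[OF H' i that] .
  \<comment> \<open>By uniqueness on each side, \<open>a\<close> and \<open>d\<close> are attached
    on opposite sides and each on one side only.\<close>
  obtain e f where ef: "e \<in> ?P" "f \<in> ?P" "e \<noteq> f" "?att e" "\<not> ?att' e" "?att' f" "\<not> ?att f"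
    using a d uniq uniq' by metis
  obtain g where g: "g \<in> ?P" "g \<noteq> e" "g \<noteq> f" by (rule ex_not2[OF P3])
  have natt: "\<not> ?att h" "\<not> ?att' h" if "h \<in> ?P" "h \<noteq> e" "h \<noteq> f" for h
    using uniq[OF ef(1) that(1)] uniq'[OF ef(2) that(1)] ef that by blast+
  have "h = g" if "h \<in> ?P" "h \<noteq> e" "h \<noteq> f" for h
    using hajos_one_attached[OF H i that(1) g(1)] natt[OF that] natt[OF g] by blast
  then have "?P = {e, f, g}" using ef g by blast
  then show False
    using hajos_three_attached[OF H i _ ef(3) _ _ ef(4,5,6,7) natt[OF g]] g by blast
qed

end

lemma (in adjacency) colourable_Suc_clique_number:
  assumes "finite V" "K5_minus_P3_free V" "P3_2K1_free V"
    and K: "K \<subseteq> V" "complete_on K" "4 \<le> card K"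
    and max: "\<And>Q. Q \<subseteq> V \<Longrightarrow> complete_on Q \<Longrightarrow> card Q \<le> card K"
  shows "colourable V (card K + 1)"
proof (rule ccontr)
  assume "\<not> ?thesis"
  then interpret uncolourable adj V K
    using assms by unfold_locales auto
  \<comment> \<open>A clique is paired with the representative of one of its parts, so that the
    maximum runs over both at once.\<close>
  define good where "good p \<longleftrightarrow> fst p \<subseteq> V \<and> complete_on (fst p) \<and> card (fst p) = card K \<and> snd p \<in> fst p" for p
  obtain k where "k \<in> K" using K(3) by fastforce
  then have "good (K, k)" using K by (simp add: good_def)
  moreover have "\<forall>p. good p \<longrightarrow> card (part V (fst p) (snd p)) < Suc (card V)"
    using part_sub finite_V card_mono[of V] by (simp add: part_def less_Suc_eq_le)
  ultimately obtain p where p: "good p"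
    and best: "\<forall>q. good q \<longrightarrow> card (part V (fst q) (snd q)) \<le> card (part V (fst p) (snd p))"
    using ex_has_greatest_nat[of good "(K, k)" "\<lambda>p. card (part V (fst p) (snd p))" "Suc (card V)"] by blast
  interpret p: uncolourable adj V "fst p"
    by (rule uncolourable_exchange) (use p in \<open>simp_all add: good_def\<close>)
  show False
  proof (rule p.not_largest_part)
    show "snd p \<in> fst p" using p by (simp add: good_def)
    show "card (part V L j) \<le> card (part V (fst p) (snd p))"
      if "L \<subseteq> V" "complete_on L" "card L = card (fst p)" "j \<in> L" for L j
      using best[rule_format, of "(L, j)"] p that by (simp add: good_def)
  qed
qed

section \<open>Translation to labelled graphs\<close>

lemma verts_P3_2K1: "verts P3_2K1 = {Inl 0, Inl 1, Inl 2, Inr (Inl 0), Inr (Inr 0)}"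
  by (auto simp: P3_2K1_def disjoint_union_def path_graph_def complete_graph_def
      numeral_3_eq_3 numeral_2_eq_2 less_Suc_eq)

lemma edges_P3_2K1: "edges P3_2K1 = {{Inl 0, Inl 1}, {Inl 1, Inl 2}}"
proof -
  have "{{i, Suc i} |i. Suc i < 3} = {{0, 1}, {1, 2 :: nat}}"
    by (auto simp: numeral_3_eq_3 numeral_2_eq_2 less_Suc_eq)
  moreover have "[{..<1 :: nat}]\<^bsup>2\<^esup> = {}"
    by (auto simp: nsets_def card_2_iff)
  ultimately show ?thesis
    by (simp add: P3_2K1_def disjoint_union_def path_graph_def complete_graph_def)
qed

text \<open>Both forbidden graphs live on the same five labels, so one embedding argument serves for
  the two of them.\<close>

lemma contains_induced_five_vertices:
  assumes "distinct [p, q, r, s, t]" "verts H = {Inl 0, Inl 1, Inl 2, Inr (Inl 0), Inr (Inr (0 :: nat))}"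
    and "\<And>u v. u \<in> {p, q, r, s, t} \<Longrightarrow> v \<in> {p, q, r, s, t} \<Longrightarrow>
      {u, v} \<in> edges G \<longleftrightarrow> {f u, f v} \<in> edges H"
    and "f p = Inl 0" "f q = Inl (1 :: nat)" "f r = Inl 2" "f s = Inr (Inl (0 :: nat))" "f t = Inr (Inr 0)"
    and "{p, q, r, s, t} \<subseteq> verts G"
  shows "contains_induced G H"
proof -
  have "bij_betw f {p, q, r, s, t} (verts H)"
    using assms by (auto simp: bij_betw_def inj_on_def)
  then have "graph_isomorphic (induced_subgraph G {p, q, r, s, t}) H"
    using assms(3) unfolding graph_isomorphic_def induced_subgraph_def by (intro exI[of _ f]) auto
  then show ?thesis using assms(9) unfolding contains_induced_def by blast
qed

lemma contains_induced_P3_2K1: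
  assumes "{p, q, r, s, t} \<subseteq> verts G" "distinct [p, q, r, s, t]"
    and "\<And>u. {u} \<notin> edges G"
    and "{p, q} \<in> edges G" "{q, r} \<in> edges G" "{p, r} \<notin> edges G" "{s, t} \<notin> edges G"
    and "{s, p} \<notin> edges G" "{s, q} \<notin> edges G" "{s, r} \<notin> edges G"
    and "{t, p} \<notin> edges G" "{t, q} \<notin> edges G" "{t, r} \<notin> edges G"
  shows "contains_induced G P3_2K1"
proof -
  define f :: "'a \<Rightarrow> nat + nat + nat" where
    "f = (\<lambda>_. Inr (Inr 0))(p := Inl 0, q := Inl 1, r := Inl 2, s := Inr (Inl 0))"
  have f: "f p = Inl 0" "f q = Inl 1" "f r = Inl 2" "f s = Inr (Inl 0)" "f t = Inr (Inr 0)"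
    using assms(2) by (auto simp: f_def)
  have "{u, v} \<in> edges G \<longleftrightarrow> {f u, f v} \<in> edges P3_2K1"
    if "u \<in> {p, q, r, s, t}" "v \<in> {p, q, r, s, t}" for u v
    using that assms(3-) unfolding edges_P3_2K1
    by (elim insertE emptyE; simp add: f doubleton_eq_iff insert_commute)
  then show ?thesis
    using contains_induced_five_vertices[OF assms(2) verts_P3_2K1 _ f assms(1)] by blast
qed

text \<open>In the complement of \<open>G\<close>, \<open>a - c - b\<close> is the path and
  \<open>x\<close>, \<open>y\<close> are the isolated vertices.\<close>

lemma contains_induced_complement_P3_2K1:
  assumes "{a, c, b, x, y} \<subseteq> verts G" "distinct [a, c, b, x, y]"
    and "\<And>u. {u} \<notin> edges G"
    and "{a, c} \<notin> edges G" "{c, b} \<notin> edges G" "{a, b} \<in> edges G" "{x, y} \<in> edges G"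
    and "{x, a} \<in> edges G" "{x, c} \<in> edges G" "{x, b} \<in> edges G"
    and "{y, a} \<in> edges G" "{y, c} \<in> edges G" "{y, b} \<in> edges G"
  shows "contains_induced G (graph_complement P3_2K1)"
proof -
  define f :: "'a \<Rightarrow> nat + nat + nat" where
    "f = (\<lambda>_. Inr (Inr 0))(a := Inl 0, c := Inl 1, b := Inl 2, x := Inr (Inl 0))"
  have f: "f a = Inl 0" "f c = Inl 1" "f b = Inl 2" "f x = Inr (Inl 0)" "f y = Inr (Inr 0)"
    using assms(2) by (auto simp: f_def)
  have V: "verts (graph_complement P3_2K1) = {Inl 0, Inl 1, Inl 2, Inr (Inl 0), Inr (Inr 0)}"
    using verts_P3_2K1 by (simp add: graph_complement_def)
  have pair: "{u, v} \<in> [S]\<^bsup>2\<^esup> \<longleftrightarrow> u \<in> S \<and> v \<in> S \<and> u \<noteq> v" for u v :: "nat + nat + nat" and S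
    by (auto simp: nsets_def card_insert_if)
  have E: "{u, v} \<in> edges (graph_complement P3_2K1) \<longleftrightarrow>
      u \<in> verts P3_2K1 \<and> v \<in> verts P3_2K1 \<and> u \<noteq> v \<and> {u, v} \<notin> {{Inl 0, Inl 1}, {Inl 1, Inl 2}}" for u v
    by (simp add: graph_complement_def edges_P3_2K1 pair)
  have "{u, v} \<in> edges G \<longleftrightarrow> {f u, f v} \<in> edges (graph_complement P3_2K1)"
    if "u \<in> {a, c, b, x, y}" "v \<in> {a, c, b, x, y}" for u v
    using that assms(3-) unfolding E verts_P3_2K1
    by (elim insertE emptyE; simp add: f doubleton_eq_iff insert_commute)
  then show ?thesis
    using contains_induced_five_vertices[OF assms(2) V _ f assms(1)] by blast
qed

theorem theorem3p9:
  fixes G :: "'a ugraph"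
  assumes "finite_simple_graph G"
    and "\<not> contains_induced G P3_2K1"
    and "\<not> contains_induced G (graph_complement P3_2K1)"
    and "clique_number G \<ge> 4"
  shows "chromatic_number G \<le> clique_number G + 1"
proof -
  let ?V = "verts G" and ?E = "edges G"
  have finV: "finite ?V" and loop: "\<And>u. {u} \<notin> ?E"
    using assms(1) by (auto simp: finite_simple_graph_def nsets_def)
  \<comment> \<open>Irreflexivity is the absence of singleton edges, since
    \<open>{u, u} = {u}\<close>.\<close>
  interpret adjacency "\<lambda>u v. {u, v} \<in> ?E"
    using loop by unfold_locales (simp_all add: insert_commute)
  have comm: "{v, u} \<in> ?E" if "{u, v} \<in> ?E" for u v using adj_sym[OF that] .
  have clique_iff: "clique K ?E \<longleftrightarrow> complete_on K" for K
    by (simp add: clique_def complete_on_def)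
  have P: "P3_2K1_free ?V"
    unfolding P3_2K1_free_def
  proof (intro ballI impI, rule ccontr)
    fix p q r s t
    assume V: "p \<in> ?V" "q \<in> ?V" "r \<in> ?V" "s \<in> ?V" "t \<in> ?V"
      and E: "{p, q} \<in> ?E" "{q, r} \<in> ?E" "p \<noteq> r" "{p, r} \<notin> ?E" "s \<noteq> t" "{s, t} \<notin> ?E"
      and N: "\<not> ({s, p} \<in> ?E \<or> {s, q} \<in> ?E \<or> {s, r} \<in> ?E \<or> {t, p} \<in> ?E \<or> {t, q} \<in> ?E \<or> {t, r} \<in> ?E)"
    have "distinct [p, q, r, s, t]"
      using E N loop comm by auto
    then show False
      using contains_induced_P3_2K1[of p q r s t G] V E N loop assms(2) by simp
  qed
  have K5: "K5_minus_P3_free ?V"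
    unfolding K5_minus_P3_free_def
  proof (intro ballI impI, rule ccontr)
    fix x y a b c
    assume V: "x \<in> ?V" "y \<in> ?V" "a \<in> ?V" "b \<in> ?V" "c \<in> ?V"
      and E: "complete_on {x, y, a, b}" "x \<noteq> y" "a \<noteq> b" "{c, x} \<in> ?E" "{c, y} \<in> ?E"
      and N: "\<not> ({c, a} \<in> ?E \<or> {c, b} \<in> ?E)"
    have ne: "c \<noteq> x" "c \<noteq> y" "x \<noteq> a" "x \<noteq> b" "y \<noteq> a" "y \<noteq> b" using E N loop by auto
    then have E': "{x, y} \<in> ?E" "{a, b} \<in> ?E" "{x, a} \<in> ?E" "{x, b} \<in> ?E" "{y, a} \<in> ?E" "{y, b} \<in> ?E"
      using E(1-3) by (auto simp: complete_on_def)
    have "c \<noteq> a" "c \<noteq> b" using E' N comm by auto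
    then have "distinct [a, c, b, x, y]" using ne E(2,3) by auto
    moreover have "{a, c} \<notin> ?E" "{c, b} \<notin> ?E" "{x, c} \<in> ?E" "{y, c} \<in> ?E"
      using N E(4,5) comm by blast+
    ultimately show False
      using contains_induced_complement_P3_2K1[of a c b x y G] V E' loop assms(3) by simp
  qed
  define cards where "cards = card ` {K. K \<subseteq> ?V \<and> clique K ?E}"
  have "finite cards" using finV by (simp add: cards_def)
  \<comment> \<open>The empty clique makes the set nonempty, so that \<open>Max\<close> is
    attained.\<close>
  moreover have "card ({} :: 'a set) \<in> cards" unfolding cards_def by (rule imageI) (simp add: clique_def)
  ultimately have Max: "Max cards \<in> cards" "\<And>k. k \<in> cards \<Longrightarrow> k \<le> Max cards"
    by (auto intro: Max_in)
  have num: "clique_number G = Max cards" by (simp add: clique_number_def cards_def)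
  obtain K where K: "K \<subseteq> ?V" "complete_on K" "card K = clique_number G"
    using Max(1) unfolding num by (auto simp: cards_def clique_iff)
  have "card Q \<le> card K" if "Q \<subseteq> ?V" "complete_on Q" for Q
    using Max(2)[of "card Q"] that K(3) by (auto simp: num cards_def clique_iff)
  then have "colourable ?V (clique_number G + 1)"
    using colourable_Suc_clique_number[OF finV K5 P K(1,2)] K(3) assms(4) by simp
  then have "\<exists>c. proper_colouring G (clique_number G + 1) c"
    unfolding colourable_def proper_on_def proper_colouring_def by (simp add: image_subset_iff_funcset)
  then show ?thesis
    unfolding chromatic_number_def by (rule Least_le)
qed

end
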